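(* $$\tilde F\left(\tfrac12,1\right)=\lim_{N\to\infty}\frac{1}{N^{2}}\int_{\mathrm{U}(N)}|V_U(0)|\,|V_U'(0)|\,d\mu^{\rm Haar}=\frac{e^2-5}{4\pi}.$$
   Context: $\mathrm{U}(N)$ is the group of $N\times N$ unitary matrices with normalised (probability) Haar measure $\mu^{\rm Haar}$. For $U\in\mathrm{U}(N)$ with eigenvalues $e^{i\theta_1},\dots,e^{i\theta_N}$ ($\theta_n\in[0,2\pi)$) put $Z_U(\theta)=\prod_{n=1}^N(1-e^{i(\theta_n-\theta)})$ and $V_U(\theta)=\exp\left(iN\frac{\theta+\pi}{2}-i\sum_{n=1}^N\frac{\theta_n}{2}\right)Z_U(\theta)$, which is real-valued. For $h>-1/2$ and $k>h-1/2$, $\tilde F_N(h,k)=\int_{\mathrm{U}(N)}|V_U(0)|^{2k-2h}|V_U'(0)|^{2h}\,d\mu^{\rm Haar}$ and $\tilde F(h,k)=\lim_{N\to\infty}N^{-k^2-2h}\tilde F_N(h,k)$. *)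

theory Defs
  imports
    "HOL-Probability.Probability"
    "Jordan_Normal_Form.Schur_Decomposition"
begin

definition unitary_group :: "nat \<Rightarrow> complex mat set" where
  "unitary_group N =
     {U \<in> carrier_mat N N. mat_adjoint U * U = 1\<^sub>m N \<and> U * mat_adjoint U = 1\<^sub>m N}"

(* The trace on U(N) of the Borel sets of C^(N x N): the sigma-algebra generated by the
   matrix entries, which is the Borel sigma-algebra of the usual topology of U(N). *)
definition unitary_borel :: "nat \<Rightarrow> complex mat measure" where
  "unitary_borel N =
     vimage_algebra (unitary_group N)
       (\<lambda>U. \<lambda>ij \<in> {..<N} \<times> {..<N}. U $$ ij)
       (\<Pi>\<^sub>M ij \<in> {..<N} \<times> {..<N}. borel)"

(* Left invariance; as U(N) is compact, right invariance and uniqueness follow. *)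
definition is_haar_measure :: "nat \<Rightarrow> complex mat measure \<Rightarrow> bool" where
  "is_haar_measure N \<mu> \<longleftrightarrow>
     prob_space \<mu> \<and> space \<mu> = unitary_group N \<and> sets \<mu> = sets (unitary_borel N) \<and>
     (\<forall>A \<in> unitary_group N. distr \<mu> \<mu> (\<lambda>U. A * U) = \<mu>)"

(* Eigenvalues with algebraic multiplicity; Arg2pi takes values in [0, 2 pi). *)
definition eigenangles :: "complex mat \<Rightarrow> real multiset" where
  "eigenangles U = image_mset Arg2pi (proots (char_poly U))"

definition Z_fun :: "complex mat \<Rightarrow> real \<Rightarrow> complex" where
  "Z_fun U \<theta> = (\<Prod>t \<in># eigenangles U. 1 - exp (\<i> * of_real (t - \<theta>)))"

(* For unitary U this takes real values; it is kept complex-valued, so that absolute values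
   of it and of its derivative in the real variable are expressed by cmod. *)
definition V_fun :: "complex mat \<Rightarrow> real \<Rightarrow> complex" where
  "V_fun U \<theta> =
     exp (\<i> * of_nat (dim_row U) * of_real ((\<theta> + pi) / 2)
          - \<i> * of_real (\<Sum>t \<in># eigenangles U. t / 2)) * Z_fun U \<theta>"

definition V_deriv :: "complex mat \<Rightarrow> real \<Rightarrow> complex" where
  "V_deriv U \<theta> = vector_derivative (V_fun U) (at \<theta>)"

(* Meaningful for h > -1/2 and k > h - 1/2. For real exponents x powr y is 0 at x = 0 even if
   y <= 0, which for N >= 1 only concerns a set of Haar measure zero. *)
definition F_fin :: "(nat \<Rightarrow> complex mat measure) \<Rightarrow> nat \<Rightarrow> real \<Rightarrow> real \<Rightarrow> real" where
  "F_fin \<mu> N h k =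
     (\<integral>U. cmod (V_fun U 0) powr (2 * k - 2 * h) * cmod (V_deriv U 0) powr (2 * h) \<partial>\<mu> N)"

definition F_lim :: "(nat \<Rightarrow> complex mat measure) \<Rightarrow> real \<Rightarrow> real \<Rightarrow> real" where
  "F_lim \<mu> h k = lim (\<lambda>N. real N powr (- (k ^ 2) - 2 * h) * F_fin \<mu> N h k)"

end

(*
  Write Z(r) = det(1 - r U) and T(r) = tr(r U (1 - r U)^(-1)). Logarithmic differentiation gives
  |V(0) V'(0)| = |Z(1)|^2 |y| with y = Im T(1), while Re T(1) = -N/2.

  For polynomials F in the entries of U, left invariance under row permutations and row phases alone
  yields E[F e_j conj(e_k)] = E[F conj(e_(k-j))] for the elementary symmetric functions e_k of the
  eigenvalues. Applied to the powers of T(r) this computes E[Z(r) exp(-2 s T(r)) conj(Z(1))], and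
  r -> 1 gives the Laguerre polynomial
    E[|Z(1)|^2 cos(2 s y)] = exp(-N s) sum_j binomial(N+1, j+1) (2 s)^j / j!.

  Finally |y| = (1/pi) int_0^oo (1 - cos(2 s y)) / s^2 ds turns E[|Z(1)|^2 |y|] into an explicit
  finite sum, whose limit follows by dominated convergence and telescoping.
*)

theory Submission
  imports Defs "HOL-Real_Asymp.Real_Asymp"
begin

section \<open>Minors and polynomials in the matrix entries\<close>

text \<open>The obstacle is that T(1) is unbounded: it blows up as an eigenvalue approaches 1, so
  exp(-2 s T(1)) cannot be expanded under the integral. For fixed |r| < 1 the bound |T(r)| <= N / (1
  - |r|) allows this expansion, and also the approximation of T(r) by polynomials in the entries,
  namely partial sums of its power series in r, whose coefficients are the power sums of the
  eigenvalues. The passage r -> 1 is made for the exponential as a whole, where Re T(r) >= -N/2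
  gives the bound exp(s N), independent of r. Only one of the two factors Z carries r. The
  conjugated one stays at 1 and is a linear combination of the conj(e_k), because the identity for
  E[F e_j conj(e_k)] requires F to be free of conjugates. That identity replaces the joint density
  of the eigenvalues: e_k is a sum of principal minors, and rows are stripped from a conjugated
  minor one at a time. The kernel (1 - cos(2 s y)) / s^2 is nonnegative, so the two integrations can
  be exchanged without knowing in advance that |Z(1)|^2 |y| is integrable.\<close>

text \<open>The minor with rows \<open>R\<close> and columns \<open>c ` R\<close>. Keeping \<open>c\<close> as a labelling of the columns by the
  rows, rather than a set of columns, reduces all signs of cofactor expansions to signs of
  transpositions.\<close>

definition minor :: "nat set \<Rightarrow> (nat \<Rightarrow> nat) \<Rightarrow> (nat \<Rightarrow> nat \<Rightarrow> complex) \<Rightarrow> complex" where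
  "minor R c u = (\<Sum>p | p permutes R. of_int (sign p) * (\<Prod>i\<in>R. u i (c (p i))))"

text \<open>With rows as functions, replacing row \<open>a\<close> by row \<open>e\<close> is the
  function update \<open>(entries U)(a := entries U e)\<close>.\<close>

definition entries :: "complex mat \<Rightarrow> nat \<Rightarrow> nat \<Rightarrow> complex" where
  "entries U i j = U $$ (i, j)"

text \<open>The k-th elementary symmetric function of the eigenvalues, up to the identification in
  \<open>secular_eq_prod\<close>. Principal minors make it visibly a polynomial in the
  entries.\<close>

definition esym :: "nat \<Rightarrow> nat \<Rightarrow> complex mat \<Rightarrow> complex" where
  "esym N k U = (\<Sum>I | I \<subseteq> {..<N} \<and> card I = k. minor I id (entries U))"

lemma minor_cong:
  assumes "\<And>i j. i \<in> R \<Longrightarrow> j \<in> R \<Longrightarrow> u i (c j) = v i (d j)"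
  shows "minor R c u = minor R d v"
  unfolding minor_def
  by (intro sum.cong refl arg_cong2[of _ _ _ _ "(*)"] prod.cong)
     (auto simp: permutes_in_image assms)

lemma minor_empty [simp]: "minor {} c u = 1"
  by (simp add: minor_def)

text \<open>Laplace expansion along row \<open>a\<close>. Each permutation of \<open>R\<close> is
  uniquely a permutation fixing \<open>a\<close> followed by a transposition of \<open>a\<close> and
  some \<open>b\<close>; the latter sends row \<open>a\<close> to column \<open>c b\<close> and
  relabels the columns of the other rows. The sign is 1 for \<open>b = a\<close> and -1
  otherwise.\<close>

lemma minor_expand:
  assumes "finite R" "a \<in> R"
  shows "minor R c u =
    (\<Sum>b\<in>R. of_int (sign (Transposition.transpose a b)) * u a (c b) *
      minor (R - {a}) (c \<circ> Transposition.transpose a b) u)"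
proof -
  define S where "S = R - {a}"
  have R: "R = insert a S" and S: "finite S" "a \<notin> S"
    using assms by (auto simp: S_def)
  have "minor R c u = (\<Sum>b\<in>insert a S. \<Sum>q | q permutes S.
      of_int (sign (Transposition.transpose a b \<circ> q)) *
      (\<Prod>i\<in>insert a S. u i (c ((Transposition.transpose a b \<circ> q) i))))"
    unfolding minor_def R by (rule sum_over_permutations_insert[OF S])
  also have "\<dots> = (\<Sum>b\<in>insert a S. of_int (sign (Transposition.transpose a b)) * u a (c b) *
      minor S (c \<circ> Transposition.transpose a b) u)"
  proof (intro sum.cong refl)
    fix b assume "b \<in> insert a S"
    show "(\<Sum>q | q permutes S. of_int (sign (Transposition.transpose a b \<circ> q)) *
        (\<Prod>i\<in>insert a S. u i (c ((Transposition.transpose a b \<circ> q) i)))) =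
      of_int (sign (Transposition.transpose a b)) * u a (c b) *
        minor S (c \<circ> Transposition.transpose a b) u"
      unfolding minor_def sum_distrib_left
    proof (intro sum.cong refl)
      fix q assume q: "q \<in> {q. q permutes S}"
      have "q a = a" using q S by (auto simp: permutes_def)
      moreover have "sign (Transposition.transpose a b \<circ> q) =
          sign (Transposition.transpose a b) * sign q"
        using q S by (intro sign_compose permutation_swap_id) (auto simp: permutation_permutes)
      ultimately show "of_int (sign (Transposition.transpose a b \<circ> q)) *
          (\<Prod>i\<in>insert a S. u i (c ((Transposition.transpose a b \<circ> q) i))) =
        of_int (sign (Transposition.transpose a b)) * u a (c b) *
          (of_int (sign q) * (\<Prod>i\<in>S. u i ((c \<circ> Transposition.transpose a b) (q i))))"
        using S by simp
    qed
  qed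
  finally show ?thesis by (simp add: R S)
qed

text \<open>Composing all permutations with the transposition of the two rows keeps each product and
  flips each sign, so the sum equals its negative.\<close>

lemma minor_equal_rows:
  assumes R: "finite R" "a \<in> R" "e \<in> R" "a \<noteq> e" and eq: "u a = u e"
  shows "minor R c u = 0"
proof -
  let ?t = "Transposition.transpose a e"
  have t: "?t permutes R" using R by (intro permutes_swap_id)
  have "minor R c u = (\<Sum>p | p permutes R. of_int (sign (p \<circ> ?t)) *
      (\<Prod>i\<in>R. u i (c ((p \<circ> ?t) i))))"
    unfolding minor_def by (rule sum_permutations_compose_right[OF t])
  also have "\<dots> = (\<Sum>p | p permutes R. - (of_int (sign p) * (\<Prod>i\<in>R. u i (c (p i)))))"
  proof (intro sum.cong refl)
    fix p assume p: "p \<in> {p. p permutes R}"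
    have s: "sign (p \<circ> ?t) = - sign p"
    proof -
      have "permutation p" using p R(1) by (auto simp: permutation_permutes)
      thus ?thesis using R(4) by (simp add: sign_compose permutation_swap_id sign_swap_id)
    qed
    have "(\<Prod>i\<in>R. u i (c ((p \<circ> ?t) i))) = (\<Prod>i\<in>R. u (?t i) (c (p (?t i))))"
      using eq by (intro prod.cong) (auto simp: Transposition.transpose_def)
    also have "\<dots> = (\<Prod>i\<in>R. u i (c (p i)))"
      using prod.permute[OF t, of "\<lambda>i. u i (c (p i))"] by (simp add: o_def)
    finally show "of_int (sign (p \<circ> ?t)) * (\<Prod>i\<in>R. u i (c ((p \<circ> ?t) i))) =
        - (of_int (sign p) * (\<Prod>i\<in>R. u i (c (p i))))" by (simp add: s)
  qed
  also have "\<dots> = - minor R c u" by (simp add: minor_def sum_negf)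
  finally show ?thesis by simp
qed

lemma esym_0 [simp]: "esym N 0 U = 1"
proof -
  have "{I. I \<subseteq> {..<N} \<and> card I = 0} = {{}}"
    by (auto dest: finite_subset[OF _ finite_lessThan])
  thus ?thesis by (simp add: esym_def)
qed

lemma esym_eq_0: "k > N \<Longrightarrow> esym N k U = 0"
proof -
  assume "k > N"
  have "card I \<noteq> k" if "I \<subseteq> {..<N}" for I
    using card_mono[OF finite_lessThan that] \<open>k > N\<close> by simp
  hence "{I. I \<subseteq> {..<N} \<and> card I = k} = {}" by blast
  thus ?thesis by (simp only: esym_def sum.empty)
qed

section \<open>Polynomials in the matrix entries, without conjugates\<close>

definition monomial :: "(nat \<times> nat) list \<Rightarrow> complex mat \<Rightarrow> complex" where
  "monomial L U = (\<Prod>(i, j)\<leftarrow>L. U $$ (i, j))"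

text \<open>Built by adding one monomial at a time, so that rule induction reduces an identity
  linear in \<open>F\<close> to monomials, on which row phases act by scalars.\<close>

inductive entry_poly :: "nat \<Rightarrow> (complex mat \<Rightarrow> complex) \<Rightarrow> bool" for N where
  entry_poly_0: "entry_poly N (\<lambda>U. 0)"
| entry_poly_step: "entry_poly N F \<Longrightarrow> set L \<subseteq> {..<N} \<times> {..<N} \<Longrightarrow>
    entry_poly N (\<lambda>U. F U + x * monomial L U)"

lemma entry_poly_monomial: "set L \<subseteq> {..<N} \<times> {..<N} \<Longrightarrow> entry_poly N (\<lambda>U. x * monomial L U)"
  using entry_poly_step[OF entry_poly_0] by simp

lemma entry_poly_const: "entry_poly N (\<lambda>U. x)"
  using entry_poly_monomial[of "[]" N x] by (simp add: monomial_def)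

lemma entry_poly_entry: "i < N \<Longrightarrow> j < N \<Longrightarrow> entry_poly N (\<lambda>U. entries U i j)"
  using entry_poly_monomial[of "[(i,j)]" N 1] by (simp add: monomial_def entries_def)

lemma entry_poly_add:
  assumes "entry_poly N F" "entry_poly N G"
  shows "entry_poly N (\<lambda>U. F U + G U)"
  using assms(2)
proof induction
  case (entry_poly_step G L x)
  from entry_poly.entry_poly_step[OF entry_poly_step.IH entry_poly_step.hyps(2), of x]
  show ?case by (simp add: add_ac)
qed (simp add: assms)

lemma monomial_append: "monomial (L @ L') U = monomial L U * monomial L' U"
  by (simp add: monomial_def)

lemma entry_poly_mult_monomial:
  assumes "entry_poly N F" "set L \<subseteq> {..<N} \<times> {..<N}"
  shows "entry_poly N (\<lambda>U. F U * (x * monomial L U))"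
  using assms(1)
proof induction
  case entry_poly_0
  show ?case by (simp add: entry_poly_const)
next
  case (entry_poly_step F L' y)
  have "set (L' @ L) \<subseteq> {..<N} \<times> {..<N}"
    using assms(2) entry_poly_step.hyps(2) by auto
  from entry_poly.entry_poly_step[OF entry_poly_step.IH this, of "x * y"]
  show ?case by (simp add: monomial_append algebra_simps)
qed

lemma entry_poly_mult:
  assumes "entry_poly N F" "entry_poly N G"
  shows "entry_poly N (\<lambda>U. F U * G U)"
  using assms(2)
proof induction
  case entry_poly_0
  show ?case by (simp add: entry_poly_const)
next
  case (entry_poly_step G L x)
  have "entry_poly N (\<lambda>U. F U * G U + F U * (x * monomial L U))"
    by (intro entry_poly_add entry_poly_step.IH entry_poly_mult_monomial assms(1) entry_poly_step.hyps)
  thus ?case by (simp add: algebra_simps)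
qed

lemma entry_poly_sum:
  "(\<And>i. i \<in> A \<Longrightarrow> entry_poly N (F i)) \<Longrightarrow> entry_poly N (\<lambda>U. \<Sum>i\<in>A. F i U)"
  by (induction A rule: infinite_finite_induct) (auto intro: entry_poly_add entry_poly_const)

lemma entry_poly_prod:
  "(\<And>i. i \<in> A \<Longrightarrow> entry_poly N (F i)) \<Longrightarrow> entry_poly N (\<lambda>U. \<Prod>i\<in>A. F i U)"
  by (induction A rule: infinite_finite_induct) (auto intro: entry_poly_mult entry_poly_const)

lemma entry_poly_power: "entry_poly N F \<Longrightarrow> entry_poly N (\<lambda>U. F U ^ n)"
  by (induction n) (auto intro: entry_poly_mult entry_poly_const)

lemma entry_poly_minor:
  assumes "R \<subseteq> {..<N}" "c ` R \<subseteq> {..<N}"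
  shows "entry_poly N (\<lambda>U. minor R c (entries U))"
  unfolding minor_def using assms
  by (intro entry_poly_sum entry_poly_mult entry_poly_const entry_poly_prod entry_poly_entry)
     (auto simp: permutes_in_image image_subset_iff)

lemma entry_poly_esym: "entry_poly N (esym N k)"
proof -
  have "entry_poly N (\<lambda>U. esym N k U)"
    unfolding esym_def by (intro entry_poly_sum entry_poly_minor) auto
  thus ?thesis by simp
qed

section \<open>Orthonormality of the columns of a unitary matrix\<close>

lemma unitary_group_columns:
  assumes U: "U \<in> unitary_group N" and jk: "j < N" "k < N"
  shows "(\<Sum>i<N. U $$ (i, j) * cnj (U $$ (i, k))) = (if j = k then 1 else 0)"
proof -
  have carr: "U \<in> carrier_mat N N" and eq: "mat_adjoint U * U = 1\<^sub>m N"
    using U by (auto simp: unitary_group_def)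
  have "(mat_adjoint U * U) $$ (k, j) = (\<Sum>i<N. U $$ (i, j) * cnj (U $$ (i, k)))"
    using carr jk
    by (auto simp: mat_adjoint_def scalar_prod_def mat_of_rows_def lessThan_atLeast0 mult_ac
             intro!: sum.cong)
  thus ?thesis using jk by (auto simp: eq)
qed

lemma unitary_group_entry_le_1:
  assumes U: "U \<in> unitary_group N" and ij: "i < N" "j < N"
  shows "cmod (U $$ (i, j)) \<le> 1"
proof -
  have "complex_of_real (\<Sum>i<N. (cmod (U $$ (i, j)))\<^sup>2) = 1"
    using unitary_group_columns[OF U ij(2) ij(2)]
    by (simp only: of_real_sum complex_norm_square refl if_True)
  hence "(\<Sum>i<N. (cmod (U $$ (i, j)))\<^sup>2) = 1"
    by (simp only: of_real_eq_1_iff)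
  moreover have "(cmod (U $$ (i, j)))\<^sup>2 \<le> (\<Sum>i<N. (cmod (U $$ (i, j)))\<^sup>2)"
    using ij by (intro member_le_sum) auto
  ultimately have "(cmod (U $$ (i, j)))\<^sup>2 \<le> 1\<^sup>2" by simp
  thus ?thesis by (rule power2_le_imp_le) simp
qed

text \<open>Expanding along row \<open>a\<close>, while this row runs through the rows
  \<open>e\<close> of \<open>U\<close>, produces inner products of the columns \<open>c b\<close>
  and \<open>c b'\<close>. As \<open>c\<close> is injective on \<open>R\<close>, only
  \<open>b' = b\<close> survives.\<close>

lemma cofactor_column_sum:
  assumes U: "U \<in> unitary_group N" and R: "R \<subseteq> {..<N}" "a \<in> R" "b \<in> R"
    and c: "c ` R \<subseteq> {..<N}" "inj_on c R"
  shows "(\<Sum>e\<in>{..<N} - (R - {a}). U $$ (e, c b) * cnj (minor R c ((entries U)(a := entries U e)))) =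
    of_int (sign (Transposition.transpose a b)) *
      cnj (minor (R - {a}) (c \<circ> Transposition.transpose a b) (entries U))"
proof -
  have fR: "finite R" using R(1) finite_subset by blast
  let ?m = "\<lambda>b'. minor (R - {a}) (c \<circ> Transposition.transpose a b') (entries U)"
  let ?s = "\<lambda>b'. of_int (sign (Transposition.transpose a b')) :: complex"
  have ex: "minor R c ((entries U)(a := entries U e)) = (\<Sum>b'\<in>R. ?s b' * U $$ (e, c b') * ?m b')" for e
  proof -
    have "minor (R - {a}) d ((entries U)(a := entries U e)) = minor (R - {a}) d (entries U)" for d
      by (rule minor_cong) auto
    thus ?thesis by (subst minor_expand[OF fR R(2)]) (simp add: entries_def)
  qed
  have "(\<Sum>e\<in>{..<N} - (R - {a}). U $$ (e, c b) * cnj (minor R c ((entries U)(a := entries U e)))) =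
     (\<Sum>e<N. U $$ (e, c b) * cnj (minor R c ((entries U)(a := entries U e))))"
  proof (rule sum.mono_neutral_left)
    \<comment> \<open>The sum may be extended to all rows: for \<open>e\<close> in
      \<open>R - {a}\<close> the modified minor has two equal rows.\<close>
    show "\<forall>e\<in>{..<N} - ({..<N} - (R - {a})).
        U $$ (e, c b) * cnj (minor R c ((entries U)(a := entries U e))) = 0"
    proof
      fix e assume e: "e \<in> {..<N} - ({..<N} - (R - {a}))"
      have "minor R c ((entries U)(a := entries U e)) = 0"
        by (rule minor_equal_rows[of R a e]) (use e fR R in auto)
      thus "U $$ (e, c b) * cnj (minor R c ((entries U)(a := entries U e))) = 0" by simp
    qed
  qed auto
  also have "\<dots> = (\<Sum>e<N. \<Sum>b'\<in>R. ?s b' * cnj (?m b') * (U $$ (e, c b) * cnj (U $$ (e, c b'))))"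
    by (simp add: ex sum_distrib_left mult_ac)
  also have "\<dots> = (\<Sum>b'\<in>R. ?s b' * cnj (?m b') * (\<Sum>e<N. U $$ (e, c b) * cnj (U $$ (e, c b'))))"
    by (subst sum.swap) (simp add: sum_distrib_left)
  also have "\<dots> = (\<Sum>b'\<in>R. ?s b' * cnj (?m b') * (if b = b' then 1 else 0))"
  proof (intro sum.cong refl)
    fix b' assume b': "b' \<in> R"
    have "c b = c b' \<longleftrightarrow> b = b'" using c(2) R(3) b' by (auto dest: inj_onD)
    thus "?s b' * cnj (?m b') * (\<Sum>e<N. U $$ (e, c b) * cnj (U $$ (e, c b'))) =
      ?s b' * cnj (?m b') * (if b = b' then 1 else 0)"
      using c(1) R(3) b' by (subst unitary_group_columns[OF U]) auto
  qed
  also have "\<dots> = ?s b * cnj (?m b)"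
    using fR R(3) by (simp add: if_distrib cong: if_cong)
  finally show ?thesis .
qed

section \<open>Invariance under row operations\<close>

lemma monomial_row_phase:
  assumes L: "set L \<subseteq> {..<N} \<times> {..<N}" and a: "a < N"
    and V: "\<And>i j. i < N \<Longrightarrow> j < N \<Longrightarrow> V $$ (i, j) = (if i = a then z else 1) * U $$ (i, j)"
  shows "monomial L V = z ^ length (filter (\<lambda>(i, j). i = a) L) * monomial L U"
  using L by (induction L) (auto simp: monomial_def V)

lemma minor_row_phase:
  assumes R: "R \<subseteq> {..<N}" "c ` R \<subseteq> {..<N}"
    and V: "\<And>i j. i < N \<Longrightarrow> j < N \<Longrightarrow> V $$ (i, j) = (if i = a then z else 1) * U $$ (i, j)"
  shows "minor R c (entries V) = (if a \<in> R then z else 1) * minor R c (entries U)"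
proof -
  have fR: "finite R" using R(1) finite_subset by blast
  have "(\<Prod>i\<in>R. entries V i (c (p i))) = (if a \<in> R then z else 1) * (\<Prod>i\<in>R. entries U i (c (p i)))"
    if p: "p permutes R" for p
  proof -
    have "(\<Prod>i\<in>R. entries V i (c (p i))) = (\<Prod>i\<in>R. (if i = a then z else 1) * entries U i (c (p i)))"
      using R p by (intro prod.cong refl) (auto simp: entries_def permutes_in_image image_subset_iff subset_iff V)
    thus ?thesis using fR by (simp add: prod.distrib prod.delta)
  qed
  thus ?thesis by (simp add: minor_def sum_distrib_left mult_ac)
qed

lemma monomial_swap_rows:
  assumes L: "set L \<subseteq> ({..<N} - {a, e}) \<times> {..<N}"
    and V: "\<And>i j. i < N \<Longrightarrow> j < N \<Longrightarrow> V $$ (i, j) = U $$ (Transposition.transpose a e i, j)"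
  shows "monomial L V = monomial L U"
  using L by (induction L) (auto simp: monomial_def V)

locale haar =
  fixes N :: nat and M :: "complex mat measure"
  assumes haar_measure: "is_haar_measure N M"
begin

lemma space_eq: "space M = unitary_group N"
  and sets_eq: "sets M = sets (unitary_borel N)"
  and prob: "prob_space M"
  using haar_measure by (auto simp: is_haar_measure_def)

lemma measurable_entry:
  assumes "i < N" "j < N"
  shows "(\<lambda>U. U $$ (i, j)) \<in> borel_measurable M"
proof -
  have "(\<lambda>U. \<lambda>ij \<in> {..<N} \<times> {..<N}. U $$ ij) \<in>
      measurable (unitary_borel N) (\<Pi>\<^sub>M ij \<in> {..<N} \<times> {..<N}. (borel :: complex measure))"
    unfolding unitary_borel_def by (rule measurable_vimage_algebra1) (auto simp: space_PiM)
  hence "(\<lambda>U. (\<lambda>ij \<in> {..<N} \<times> {..<N}. U $$ ij) (i, j)) \<in> borel_measurable (unitary_borel N)"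
    by (rule measurable_compose) (use assms in \<open>auto intro!: measurable_component_singleton\<close>)
  thus ?thesis using assms by (simp cong: measurable_cong_sets add: sets_eq)
qed

lemma measurable_left_mult:
  assumes A: "A \<in> carrier_mat N N" and AU: "\<And>U. U \<in> unitary_group N \<Longrightarrow> A * U \<in> unitary_group N"
  shows "(\<lambda>U. A * U) \<in> measurable M M"
proof -
  have "(\<lambda>U. \<lambda>ij \<in> {..<N} \<times> {..<N}. (A * U) $$ ij) \<in>
      measurable M (\<Pi>\<^sub>M ij \<in> {..<N} \<times> {..<N}. (borel :: complex measure))"
  proof (rule measurable_restrict)
    fix ij assume ij: "ij \<in> {..<N} \<times> {..<N}"
    obtain i j where [simp]: "ij = (i, j)" by (cases ij)
    have "(\<lambda>U. \<Sum>k<N. A $$ (i, k) * U $$ (k, j)) \<in> borel_measurable M"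
      using ij by (intro borel_measurable_sum borel_measurable_times measurable_entry) auto
    moreover have "(A * U) $$ ij = (\<Sum>k<N. A $$ (i, k) * U $$ (k, j))" if "U \<in> space M" for U
    proof -
      have "U \<in> carrier_mat N N" using that by (simp add: space_eq unitary_group_def)
      thus ?thesis using A ij by (auto simp: scalar_prod_def lessThan_atLeast0 intro!: sum.cong)
    qed
    ultimately show "(\<lambda>U. (A * U) $$ ij) \<in> borel_measurable M"
      by (simp cong: measurable_cong)
  qed
  hence "(\<lambda>U. A * U) \<in> measurable M (unitary_borel N)"
    unfolding unitary_borel_def by (intro measurable_vimage_algebra2) (use AU space_eq in auto)
  thus ?thesis by (simp cong: measurable_cong_sets add: sets_eq)
qed

lemma integral_left_mult:
  fixes f :: "complex mat \<Rightarrow> complex"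
  assumes A: "A \<in> unitary_group N" and AU: "\<And>U. U \<in> unitary_group N \<Longrightarrow> A * U \<in> unitary_group N"
    and f: "f \<in> borel_measurable M"
  shows "(\<integral>U. f U \<partial>M) = (\<integral>U. f (A * U) \<partial>M)"
proof -
  have m: "(\<lambda>U. A * U) \<in> measurable M M"
    by (rule measurable_left_mult[OF _ AU]) (use A in \<open>auto simp: unitary_group_def\<close>)
  have "(\<integral>U. f U \<partial>M) = (\<integral>U. f U \<partial>(distr M M (\<lambda>U. A * U)))"
    using haar_measure A by (simp add: is_haar_measure_def)
  thus ?thesis by (simp add: integral_distr[OF m f])
qed

text \<open>Every use of Haar invariance passes through this lemma. The acting matrix has the entry
  \<open>d i\<close> at position \<open>(i, \<sigma> i)\<close> and zeros elsewhere. Letting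
  \<open>V\<close> range over all matrices with the prescribed entries spares its users any
  computation with matrix products.\<close>

lemma integral_row_action:
  fixes f :: "complex mat \<Rightarrow> complex"
  assumes \<sigma>: "\<sigma> permutes {..<N}" and d: "\<And>i. cmod (d i) = 1"
    and f: "f \<in> borel_measurable M"
    and g: "\<And>U V. U \<in> unitary_group N \<Longrightarrow>
      (\<And>i j. i < N \<Longrightarrow> j < N \<Longrightarrow> V $$ (i, j) = d i * U $$ (\<sigma> i, j)) \<Longrightarrow> f V = g U"
  shows "(\<integral>U. f U \<partial>M) = (\<integral>U. g U \<partial>M)"
proof -
  define A where "A = mat N N (\<lambda>(i, j). if j = \<sigma> i then d i else 0)"
  have dd: "cnj (d i) * d i = 1" "d i * cnj (d i) = 1" for i
    using d[of i] by (simp_all add: complex_mult_cnj cmod_def mult.commute[of "cnj _"])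
  have \<sigma>i: "\<sigma> i < N \<longleftrightarrow> i < N" for i using permutes_in_image[OF \<sigma>] by auto
  have \<sigma>inj: "\<sigma> i = \<sigma> j \<longleftrightarrow> i = j" for i j using permutes_inj[OF \<sigma>] by (auto dest: injD)
  have Ac: "A \<in> carrier_mat N N" by (simp add: A_def)
  have Aent: "A $$ (i, j) = (if j = \<sigma> i then d i else 0)" if "i < N" "j < N" for i j
    using that by (simp add: A_def)
  have adj: "mat_adjoint A $$ (i, j) = (if i = \<sigma> j then cnj (d j) else 0)" if "i < N" "j < N" for i j
    using that by (auto simp: A_def mat_adjoint_def mat_of_rows_def)
  have adjc: "mat_adjoint A \<in> carrier_mat N N" using Ac by (auto simp: mat_adjoint_def)
  have "mat_adjoint A * A = 1\<^sub>m N"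
  proof (rule eq_matI)
    fix i j assume ij: "i < dim_row (1\<^sub>m N :: complex mat)" "j < dim_col (1\<^sub>m N :: complex mat)"
    have "(mat_adjoint A * A) $$ (i, j) = (\<Sum>k<N. mat_adjoint A $$ (i, k) * A $$ (k, j))"
      using ij Ac adjc by (auto simp: scalar_prod_def lessThan_atLeast0 intro!: sum.cong)
    also have "\<dots> = (\<Sum>k<N. if i = \<sigma> k \<and> i = j then 1 else 0)"
      using ij by (intro sum.cong refl) (auto simp: adj Aent dd)
    also have "\<dots> = (\<Sum>k<N. if k = inv_into UNIV \<sigma> i then (if i = j then 1 else 0) else 0)"
      by (intro sum.cong refl) (auto simp: permutes_inverses[OF \<sigma>])
    also have "\<dots> = (if i = j then 1 else 0)"
      using ij permutes_in_image[OF permutes_inv[OF \<sigma>], of i] by (simp add: sum.delta)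
    finally show "(mat_adjoint A * A) $$ (i, j) = 1\<^sub>m N $$ (i, j)" using ij by simp
  qed (use Ac adjc in auto)
  moreover have "A * mat_adjoint A = 1\<^sub>m N"
  proof (rule eq_matI)
    fix i j assume ij: "i < dim_row (1\<^sub>m N :: complex mat)" "j < dim_col (1\<^sub>m N :: complex mat)"
    have "(A * mat_adjoint A) $$ (i, j) = (\<Sum>k<N. A $$ (i, k) * mat_adjoint A $$ (k, j))"
      using ij Ac adjc by (auto simp: scalar_prod_def lessThan_atLeast0 intro!: sum.cong)
    also have "\<dots> = (\<Sum>k<N. if k = \<sigma> i then (if i = j then 1 else 0) else 0)"
      using ij by (intro sum.cong refl) (auto simp: adj Aent dd \<sigma>inj)
    also have "\<dots> = (if i = j then 1 else 0)"
      using ij \<sigma>i by (simp add: sum.delta)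
    finally show "(A * mat_adjoint A) $$ (i, j) = 1\<^sub>m N $$ (i, j)" using ij by simp
  qed (use Ac adjc in auto)
  ultimately have A: "A \<in> unitary_group N" using Ac by (simp add: unitary_group_def)
  have ent: "(A * U) $$ (i, j) = d i * U $$ (\<sigma> i, j)"
    if "U \<in> carrier_mat N N" "i < N" "j < N" for U i j
  proof -
    have "(A * U) $$ (i, j) = (\<Sum>k<N. A $$ (i, k) * U $$ (k, j))"
      using that Ac by (auto simp: scalar_prod_def lessThan_atLeast0 intro!: sum.cong)
    also have "\<dots> = (\<Sum>k<N. if k = \<sigma> i then d i * U $$ (\<sigma> i, j) else 0)"
      using that by (intro sum.cong refl) (auto simp: Aent)
    also have "\<dots> = d i * U $$ (\<sigma> i, j)" using that \<sigma>i by (simp add: sum.delta)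
    finally show ?thesis .
  qed
  have AU: "A * U \<in> unitary_group N" if U: "U \<in> unitary_group N" for U
  proof -
    have Uc: "U \<in> carrier_mat N N" and U1: "mat_adjoint U * U = 1\<^sub>m N" and U2: "U * mat_adjoint U = 1\<^sub>m N"
      using U by (auto simp: unitary_group_def)
    have Uadj: "mat_adjoint U \<in> carrier_mat N N" using Uc by (auto simp: mat_adjoint_def)
    have eq: "mat_adjoint (A * U) = mat_adjoint U * mat_adjoint A"
    proof (rule eq_matI)
      fix i j assume "i < dim_row (mat_adjoint U * mat_adjoint A)" "j < dim_col (mat_adjoint U * mat_adjoint A)"
      hence ij: "i < N" "j < N" using Uadj adjc by auto
      have "mat_adjoint (A * U) $$ (i, j) = cnj ((A * U) $$ (j, i))"
        using ij Ac Uc by (auto simp: mat_adjoint_def mat_of_rows_def)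
      also have "\<dots> = (\<Sum>k<N. cnj (U $$ (k, i)) * cnj (A $$ (j, k)))"
        using ij Ac Uc by (auto simp: scalar_prod_def lessThan_atLeast0 mult_ac intro!: sum.cong)
      also have "\<dots> = (\<Sum>k<N. mat_adjoint U $$ (i, k) * mat_adjoint A $$ (k, j))"
        using ij Ac Uc by (intro sum.cong refl) (auto simp: mat_adjoint_def mat_of_rows_def)
      also have "\<dots> = (mat_adjoint U * mat_adjoint A) $$ (i, j)"
        using ij Uadj adjc by (auto simp: scalar_prod_def lessThan_atLeast0 intro!: sum.cong)
      finally show "mat_adjoint (A * U) $$ (i, j) = (mat_adjoint U * mat_adjoint A) $$ (i, j)" .
    qed (use Ac Uc in \<open>auto simp: mat_adjoint_def\<close>)
    have A1: "mat_adjoint A * A = 1\<^sub>m N" "A * mat_adjoint A = 1\<^sub>m N" using A by (auto simp: unitary_group_def)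
    have "mat_adjoint U * mat_adjoint A * (A * U) = mat_adjoint U * (mat_adjoint A * A) * U"
      using Ac Uc Uadj adjc by (simp add: assoc_mult_mat[of _ N N _ N _ N])
    hence 1: "mat_adjoint (A * U) * (A * U) = 1\<^sub>m N" using Uadj Uc by (simp add: eq A1 U1)
    have "(A * U) * (mat_adjoint U * mat_adjoint A) = A * (U * mat_adjoint U) * mat_adjoint A"
      using Ac Uc Uadj adjc by (simp add: assoc_mult_mat[of _ N N _ N _ N])
    hence 2: "(A * U) * mat_adjoint (A * U) = 1\<^sub>m N" using adjc Ac by (simp add: eq A1 U2)
    show ?thesis using 1 2 Ac Uc by (simp add: unitary_group_def)
  qed
  have "(\<integral>U. f U \<partial>M) = (\<integral>U. f (A * U) \<partial>M)"
    by (rule integral_left_mult[OF A AU f])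
  also have "\<dots> = (\<integral>U. g U \<partial>M)"
    by (rule Bochner_Integration.integral_cong[OF refl], rule g)
       (use ent in \<open>auto simp: space_eq unitary_group_def\<close>)
  finally show ?thesis .
qed

end

section \<open>Integrals against conjugated minors\<close>

text \<open>A phase z in one row multiplies a monomial of degree n in that row by z^n, and a
  conjugated minor by the conjugate of z or by 1, according to whether the row belongs to it
  (\<open>P\<close>). If the two degrees differ, some z has a visible effect.\<close>

lemma ex_phase:
  assumes "n \<noteq> (if P then 1 else 0)"
  shows "\<exists>z. cmod z = 1 \<and> z ^ n * cnj (if P then z else 1) \<noteq> 1"
proof -
  define q :: nat where "q = (if P then 1 else 0)"
  consider "n > q" | "n = 0" "P" using assms by (cases "n = 0"; cases P) (auto simp: q_def)
  thus ?thesis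
  proof cases
    case 1
    \<comment> \<open>Chosen so that the product becomes z^(n - q) = cis pi = -1.\<close>
    define z where "z = cis (pi / real (n - q))"
    have z1: "cmod z = 1" by (simp add: z_def)
    have "z ^ n * cnj (if P then z else 1) = z ^ (n - q)"
    proof (cases P)
      case True
      obtain m where n: "n = Suc m" using 1 by (cases n) auto
      have "z * cnj z = 1" using z1 by (simp add: complex_norm_square[symmetric])
      thus ?thesis using True by (simp add: n q_def)
    qed (simp add: q_def)
    also have "\<dots> = cis pi"
    proof -
      have "real (n - q) * (pi / real (n - q)) = pi" using 1 by (intro nonzero_mult_div_cancel_left[THEN trans[OF times_divide_eq_right]]) linarith
      thus ?thesis by (simp only: z_def Complex.DeMoivre)
    qed
    finally show ?thesis using z1 by (intro exI[of _ z]) auto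
  next
    case 2
    thus ?thesis by (intro exI[of _ "-1"]) auto
  qed
qed

lemma comp_transpose_image:
  assumes "c ` R \<subseteq> X" "a \<in> R" "b \<in> R"
  shows "(c \<circ> Transposition.transpose a b) ` (R - S) \<subseteq> X"
  using permutes_in_image[OF permutes_swap_id[OF assms(2,3)]] assms(1) by (auto simp: image_subset_iff)

context haar
begin

sublocale prob_space M by (rule prob)

text \<open>A class inside the integrable functions that is also closed under products, which
  integrability alone is not. The bound is asked on the unitary group only, which is the whole space
  of \<open>M\<close>.\<close>

definition bounded_measurable :: "(complex mat \<Rightarrow> complex) \<Rightarrow> bool" where
  "bounded_measurable f \<longleftrightarrow> f \<in> borel_measurable M \<and> (\<exists>B. \<forall>U\<in>unitary_group N. cmod (f U) \<le> B)"

lemma bounded_measurableI: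
  "f \<in> borel_measurable M \<Longrightarrow> (\<And>U. U \<in> unitary_group N \<Longrightarrow> cmod (f U) \<le> B) \<Longrightarrow> bounded_measurable f"
  by (auto simp: bounded_measurable_def)

lemma bounded_measurableD: "bounded_measurable f \<Longrightarrow> f \<in> borel_measurable M"
  by (simp add: bounded_measurable_def)

lemma bounded_measurable_integrable: "bounded_measurable f \<Longrightarrow> integrable M f"
  by (auto simp: bounded_measurable_def space_eq intro!: integrable_const_bound AE_I2)

lemma bounded_measurable_const: "bounded_measurable (\<lambda>U. x)"
  by (rule bounded_measurableI) auto

lemma bounded_measurable_add:
  assumes "bounded_measurable f" "bounded_measurable g"
  shows "bounded_measurable (\<lambda>U. f U + g U)"
proof -
  obtain B C where "\<forall>U\<in>unitary_group N. cmod (f U) \<le> B" "\<forall>U\<in>unitary_group N. cmod (g U) \<le> C"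
    using assms by (auto simp: bounded_measurable_def)
  thus ?thesis using assms
    by (intro bounded_measurableI[of _ "B + C"] borel_measurable_add norm_triangle_mono)
       (auto dest: bounded_measurableD)
qed

lemma bounded_measurable_mult:
  assumes "bounded_measurable f" "bounded_measurable g"
  shows "bounded_measurable (\<lambda>U. f U * g U)"
proof -
  obtain B C where "\<forall>U\<in>unitary_group N. cmod (f U) \<le> B" "\<forall>U\<in>unitary_group N. cmod (g U) \<le> C"
    using assms by (auto simp: bounded_measurable_def)
  moreover from this have "cmod (f U * g U) \<le> B * C" if "U \<in> unitary_group N" for U
    using that by (auto simp: norm_mult intro!: mult_mono order_trans[OF norm_ge_zero])
  ultimately show ?thesis using assms
    by (intro bounded_measurableI[of _ "B * C"] borel_measurable_times)
       (auto dest: bounded_measurableD)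
qed

lemma bounded_measurable_cnj:
  assumes "bounded_measurable f"
  shows "bounded_measurable (\<lambda>U. cnj (f U))"
proof -
  have "(\<lambda>U. cnj (f U)) \<in> borel_measurable M"
    using assms by (intro borel_measurable_continuous_on[OF continuous_on_cnj[OF continuous_on_id]])
      (auto dest: bounded_measurableD)
  thus ?thesis using assms by (auto simp: bounded_measurable_def)
qed

lemma bounded_measurable_sum:
  "(\<And>i. i \<in> A \<Longrightarrow> bounded_measurable (f i)) \<Longrightarrow> bounded_measurable (\<lambda>U. \<Sum>i\<in>A. f i U)"
  by (induction A rule: infinite_finite_induct)
     (auto intro: bounded_measurable_add bounded_measurable_const)

lemma bounded_measurable_power: "bounded_measurable f \<Longrightarrow> bounded_measurable (\<lambda>U. f U ^ n)"
  by (induction n) (auto intro: bounded_measurable_mult bounded_measurable_const)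

lemma bounded_measurable_entry:
  "i < N \<Longrightarrow> j < N \<Longrightarrow> bounded_measurable (\<lambda>U. U $$ (i, j))"
  by (rule bounded_measurableI[OF measurable_entry]) (auto intro: unitary_group_entry_le_1)

lemma bounded_measurable_monomial:
  "set L \<subseteq> {..<N} \<times> {..<N} \<Longrightarrow> bounded_measurable (monomial L)"
proof (induction L)
  case Nil
  show ?case using bounded_measurable_const[of 1] by (simp add: monomial_def)
next
  case (Cons ij L)
  obtain i j where ij: "ij = (i, j)" by (cases ij)
  have "monomial (ij # L) = (\<lambda>U. U $$ (i, j) * monomial L U)"
    by (simp add: monomial_def ij fun_eq_iff)
  thus ?case using Cons by (auto simp: ij intro!: bounded_measurable_mult bounded_measurable_entry)
qed

lemma bounded_measurable_entry_poly: "entry_poly N F \<Longrightarrow> bounded_measurable F"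
proof (induction rule: entry_poly.induct)
  case (entry_poly_step F L x)
  thus ?case
    by (intro bounded_measurable_add bounded_measurable_mult bounded_measurable_const
        bounded_measurable_monomial)
qed (rule bounded_measurable_const)

lemma bounded_measurable_minor:
  "R \<subseteq> {..<N} \<Longrightarrow> c ` R \<subseteq> {..<N} \<Longrightarrow> bounded_measurable (\<lambda>U. minor R c (entries U))"
  by (intro bounded_measurable_entry_poly entry_poly_minor)

lemma bounded_measurable_esym: "bounded_measurable (esym N k)"
  by (intro bounded_measurable_entry_poly entry_poly_esym)

lemmas bounded_measurable_intros =
  bounded_measurable_const bounded_measurable_add bounded_measurable_mult bounded_measurable_cnj
  bounded_measurable_sum bounded_measurable_entry bounded_measurable_monomial
  bounded_measurable_minor bounded_measurable_esym bounded_measurable_power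

text \<open>A suitable phase in row \<open>a\<close> multiplies the integrand by a scalar different
  from 1, while invariance keeps the integral the same.\<close>

lemma integral_monomial_minor_eq_0:
  assumes L: "set L \<subseteq> {..<N} \<times> {..<N}" and R: "R \<subseteq> {..<N}" "c ` R \<subseteq> {..<N}" and a: "a < N"
    and n: "length (filter (\<lambda>(i, j). i = a) L) \<noteq> (if a \<in> R then 1 else 0)"
  shows "(\<integral>U. monomial L U * cnj (minor R c (entries U)) \<partial>M) = 0"
proof -
  let ?n = "length (filter (\<lambda>(i, j). i = a) L)"
  obtain z where z: "cmod z = 1" "z ^ ?n * cnj (if a \<in> R then z else 1) \<noteq> 1"
    using ex_phase[OF n] by auto
  let ?w = "z ^ ?n * cnj (if a \<in> R then z else 1)"
  let ?f = "\<lambda>U. monomial L U * cnj (minor R c (entries U))"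
  have "(\<integral>U. ?f U \<partial>M) = (\<integral>U. ?w * ?f U \<partial>M)"
  proof (rule integral_row_action[where \<sigma> = id and d = "\<lambda>i. if i = a then z else 1"])
    fix U V :: "complex mat" assume V: "\<And>i j. i < N \<Longrightarrow> j < N \<Longrightarrow> V $$ (i, j) = (if i = a then z else 1) * U $$ (id i, j)"
    show "?f V = ?w * ?f U"
      using monomial_row_phase[OF L a, of V z U] minor_row_phase[OF R, of V a z U] V by simp
  next
    show "?f \<in> borel_measurable M"
      using L R by (intro bounded_measurableD bounded_measurable_intros)
  qed (use z in \<open>auto intro: permutes_id\<close>)
  also have "\<dots> = ?w * (\<integral>U. ?f U \<partial>M)" by simp
  finally have "(1 - ?w) * (\<integral>U. ?f U \<partial>M) = 0" by (simp add: algebra_simps)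
  thus ?thesis using z(2) by simp
qed

text \<open>Invariance under a phase in one row kills every monomial with the wrong degree in that row, so
  only monomials in the rows \<open>R - {a}\<close> contribute. For these, row \<open>a\<close> can be exchanged with any row
  outside \<open>R\<close>; averaging over the \<open>N + 1 - card R\<close> possibilities and using orthonormality of the
  columns removes row \<open>a\<close> altogether.\<close>

lemma integral_monomial_cofactor:
  assumes L: "set L \<subseteq> {..<N} \<times> {..<N}" and R: "R \<subseteq> {..<N}" "a \<in> R" "b \<in> R"
    and c: "c ` R \<subseteq> {..<N}" "inj_on c R"
  shows "of_nat (N + 1 - card R) * (\<integral>U. monomial L U * U $$ (a, c b) * cnj (minor R c (entries U)) \<partial>M) =
    of_int (sign (Transposition.transpose a b)) *
      (\<integral>U. monomial L U * cnj (minor (R - {a}) (c \<circ> Transposition.transpose a b) (entries U)) \<partial>M)"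
proof (cases "set L \<subseteq> (R - {a}) \<times> {..<N}")
  case False
  then obtain e j where ej: "(e, j) \<in> set L" "e \<notin> R - {a}" "e < N" using L by auto
  have pos: "length (filter (\<lambda>(i, j). i = e) L) > 0"
    using ej(1) by (auto simp: filter_empty_conv)
  \<comment> \<open>If \<open>e = a\<close>, the prepended factor makes the degree in row
    \<open>a\<close> at least 2, against 1 in the minor; otherwise \<open>e\<close> is not in
    \<open>R\<close> and the degrees are at least 1 and 0.\<close>
  have "(\<integral>U. monomial ((a, c b) # L) U * cnj (minor R c (entries U)) \<partial>M) = 0"
    by (rule integral_monomial_minor_eq_0[OF _ R(1) c(1) \<open>e < N\<close>]) (use pos ej L R c in auto)
  moreover have "(\<integral>U. monomial L U *
      cnj (minor (R - {a}) (c \<circ> Transposition.transpose a b) (entries U)) \<partial>M) = 0"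
    by (rule integral_monomial_minor_eq_0[OF L _ comp_transpose_image[OF c(1) R(2,3)] \<open>e < N\<close>])
       (use pos ej R in auto)
  ultimately show ?thesis by (simp add: monomial_def mult_ac)
next
  case True
  define S where "S = R - {a}"
  have fR: "finite R" using R(1) finite_subset by blast
  have cc: "c b < N" using c R by auto
  let ?m = "\<lambda>e U. minor R c ((entries U)(a := entries U e))"
  have bm: "bounded_measurable (\<lambda>U. monomial L U * U $$ (e, c b) * cnj (?m e U))" if "e < N" for e
  proof -
    have "entry_poly N (\<lambda>U. ?m e U)"
      unfolding minor_def
    proof (intro entry_poly_sum entry_poly_mult entry_poly_const entry_poly_prod)
      fix p i assume "p \<in> {p. p permutes R}" "i \<in> R"
      hence "c (p i) < N" "i < N" using R c by (auto simp: permutes_in_image image_subset_iff)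
      thus "entry_poly N (\<lambda>U. ((entries U)(a := entries U e)) i (c (p i)))"
        using \<open>e < N\<close> by (cases "i = a") (auto intro: entry_poly_entry)
    qed
    thus ?thesis using L cc that
      by (intro bounded_measurable_intros) (auto intro: bounded_measurable_entry_poly)
  qed
  have step: "(\<integral>U. monomial L U * U $$ (a, c b) * cnj (minor R c (entries U)) \<partial>M) =
      (\<integral>U. monomial L U * U $$ (e, c b) * cnj (?m e U) \<partial>M)" if e: "e \<in> {..<N} - S" for e
  proof (rule integral_row_action[where \<sigma> = "Transposition.transpose a e" and d = "\<lambda>i. 1"])
    show "Transposition.transpose a e permutes {..<N}"
      using e R by (intro permutes_swap_id) auto
    show "(\<lambda>U. monomial L U * U $$ (a, c b) * cnj (minor R c (entries U))) \<in> borel_measurable M"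
      using L R c cc by (intro bounded_measurableD bounded_measurable_intros) auto
    fix U V :: "complex mat" assume V: "\<And>i j. i < N \<Longrightarrow> j < N \<Longrightarrow> V $$ (i, j) = 1 * U $$ (Transposition.transpose a e i, j)"
    have "monomial L V = monomial L U"
      by (rule monomial_swap_rows[where a = a and e = e and N = N]) (use True R e V in \<open>auto simp: S_def\<close>)
    \<comment> \<open>Since \<open>e\<close> is not in \<open>R - {a}\<close>, exchanging rows
      \<open>a\<close> and \<open>e\<close> affects only row \<open>a\<close> of the minor.\<close>
    moreover have "minor R c (entries V) = ?m e U"
    proof (rule minor_cong)
      fix i j assume ij: "i \<in> R" "j \<in> R"
      hence "i < N" "c j < N" using R c by auto
      thus "entries V i (c j) = ((entries U)(a := entries U e)) i (c j)"
        using e ij by (auto simp: entries_def V S_def Transposition.transpose_def)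
    qed
    moreover have "V $$ (a, c b) = U $$ (e, c b)" using R cc by (simp add: V subset_iff)
    ultimately show "monomial L V * V $$ (a, c b) * cnj (minor R c (entries V)) =
        monomial L U * U $$ (e, c b) * cnj (?m e U)" by simp
  qed auto
  \<comment> \<open>The row \<open>a\<close> itself is among the rows averaged over, which accounts
    for the 1.\<close>
  have cardS: "card ({..<N} - S) = N + 1 - card R"
  proof -
    have "card ({..<N} - S) = N - card S"
      using R fR by (subst card_Diff_subset) (auto simp: S_def)
    thus ?thesis using R fR card_gt_0_iff[of R] by (auto simp: S_def card_Diff_singleton)
  qed
  have "of_nat (N + 1 - card R) * (\<integral>U. monomial L U * U $$ (a, c b) * cnj (minor R c (entries U)) \<partial>M) =
     (\<Sum>e\<in>{..<N} - S. \<integral>U. monomial L U * U $$ (e, c b) * cnj (?m e U) \<partial>M)"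
    by (simp add: step[symmetric] cardS)
  also have "\<dots> = (\<integral>U. (\<Sum>e\<in>{..<N} - S. monomial L U * U $$ (e, c b) * cnj (?m e U)) \<partial>M)"
    by (intro Bochner_Integration.integral_sum[symmetric] bounded_measurable_integrable bm) auto
  also have "\<dots> = (\<integral>U. of_int (sign (Transposition.transpose a b)) *
      (monomial L U * cnj (minor S (c \<circ> Transposition.transpose a b) (entries U))) \<partial>M)"
  proof (rule Bochner_Integration.integral_cong[OF refl])
    fix U assume "U \<in> space M"
    hence "U \<in> unitary_group N" by (simp add: space_eq)
    from cofactor_column_sum[OF this R c]
    show "(\<Sum>e\<in>{..<N} - S. monomial L U * U $$ (e, c b) * cnj (?m e U)) =
        of_int (sign (Transposition.transpose a b)) *
        (monomial L U * cnj (minor S (c \<circ> Transposition.transpose a b) (entries U)))"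
      by (simp add: S_def sum_distrib_left[symmetric] mult.assoc mult.left_commute)
  qed
  also have "\<dots> = of_int (sign (Transposition.transpose a b)) *
      (\<integral>U. monomial L U * cnj (minor S (c \<circ> Transposition.transpose a b) (entries U)) \<partial>M)"
    by simp
  finally show ?thesis by (simp add: S_def)
qed

lemma integral_cofactor:
  assumes F: "entry_poly N F" and R: "R \<subseteq> {..<N}" "a \<in> R" "b \<in> R"
    and c: "c ` R \<subseteq> {..<N}" "inj_on c R"
  shows "of_nat (N + 1 - card R) * (\<integral>U. F U * U $$ (a, c b) * cnj (minor R c (entries U)) \<partial>M) =
    of_int (sign (Transposition.transpose a b)) *
      (\<integral>U. F U * cnj (minor (R - {a}) (c \<circ> Transposition.transpose a b) (entries U)) \<partial>M)"
  using F
proof induction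
  case (entry_poly_step F L x)
  let ?t = "Transposition.transpose a b"
  have cR: "a < N" "c b < N" "(c \<circ> ?t) ` (R - {a}) \<subseteq> {..<N}" "R - {a} \<subseteq> {..<N}"
    using R c comp_transpose_image[OF c(1) R(2,3)] by auto
  note bF = bounded_measurable_entry_poly[OF entry_poly_step.hyps(1)]
  note i = bounded_measurable_integrable bounded_measurable_intros bF entry_poly_step.hyps(2) cR R c
  have "(\<integral>U. (F U + x * monomial L U) * U $$ (a, c b) * cnj (minor R c (entries U)) \<partial>M) =
    (\<integral>U. F U * U $$ (a, c b) * cnj (minor R c (entries U)) +
      x * (monomial L U * U $$ (a, c b) * cnj (minor R c (entries U))) \<partial>M)"
    by (simp add: algebra_simps)
  also have "\<dots> = (\<integral>U. F U * U $$ (a, c b) * cnj (minor R c (entries U)) \<partial>M) +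
      x * (\<integral>U. monomial L U * U $$ (a, c b) * cnj (minor R c (entries U)) \<partial>M)"
    by (subst Bochner_Integration.integral_add) (auto intro!: i)
  finally have 1: "(\<integral>U. (F U + x * monomial L U) * U $$ (a, c b) * cnj (minor R c (entries U)) \<partial>M) = \<dots>" .
  have "(\<integral>U. (F U + x * monomial L U) * cnj (minor (R - {a}) (c \<circ> ?t) (entries U)) \<partial>M) =
    (\<integral>U. F U * cnj (minor (R - {a}) (c \<circ> ?t) (entries U)) +
      x * (monomial L U * cnj (minor (R - {a}) (c \<circ> ?t) (entries U))) \<partial>M)"
    by (simp add: algebra_simps)
  also have "\<dots> = (\<integral>U. F U * cnj (minor (R - {a}) (c \<circ> ?t) (entries U)) \<partial>M) +
      x * (\<integral>U. monomial L U * cnj (minor (R - {a}) (c \<circ> ?t) (entries U)) \<partial>M)"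
    by (subst Bochner_Integration.integral_add) (auto intro!: i)
  finally have 2: "(\<integral>U. (F U + x * monomial L U) * cnj (minor (R - {a}) (c \<circ> ?t) (entries U)) \<partial>M) = \<dots>" .
  show ?case
    using entry_poly_step.IH integral_monomial_cofactor[OF entry_poly_step.hyps(2) R c]
    unfolding 1 2 by (simp add: ring_distribs mult.left_commute[of _ x] o_def)
qed simp

end

context haar
begin

text \<open>The counterpart of \<open>integral_cofactor\<close> for a row missing from the minor:
  every monomial then has degree at least 1 in row \<open>a\<close>, against 0 in the minor.\<close>

lemma integral_row_notin_eq_0:
  assumes F: "entry_poly N F" and R: "R \<subseteq> {..<N}" "c ` R \<subseteq> {..<N}" and a: "a < N" "a \<notin> R" "b < N"
  shows "(\<integral>U. F U * U $$ (a, b) * cnj (minor R c (entries U)) \<partial>M) = 0"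
  using F
proof induction
  case (entry_poly_step F L x)
  note bF = bounded_measurable_entry_poly[OF entry_poly_step.hyps(1)]
  note i = bounded_measurable_integrable bounded_measurable_intros bF entry_poly_step.hyps(2) R a
  have "(\<integral>U. (F U + x * monomial L U) * U $$ (a, b) * cnj (minor R c (entries U)) \<partial>M) =
    (\<integral>U. F U * U $$ (a, b) * cnj (minor R c (entries U)) +
      x * (monomial ((a, b) # L) U * cnj (minor R c (entries U))) \<partial>M)"
    by (simp add: algebra_simps monomial_def)
  also have "\<dots> = (\<integral>U. F U * U $$ (a, b) * cnj (minor R c (entries U)) \<partial>M) +
      x * (\<integral>U. monomial ((a, b) # L) U * cnj (minor R c (entries U)) \<partial>M)"
  proof -
    have "bounded_measurable (monomial ((a, b) # L))"
      using entry_poly_step.hyps(2) a by (intro bounded_measurable_monomial) auto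
    thus ?thesis by (subst Bochner_Integration.integral_add) (auto intro!: i)
  qed
  also have "(\<integral>U. monomial ((a, b) # L) U * cnj (minor R c (entries U)) \<partial>M) = 0"
    by (rule integral_monomial_minor_eq_0[OF _ R a(1)]) (use entry_poly_step.hyps(2) a in auto)
  finally show ?case using entry_poly_step.IH by simp
qed simp

text \<open>Expanding \<open>minor J\<close> along a row \<open>a\<close> leaves a single entry of
  row \<open>a\<close>, with which \<open>integral_cofactor\<close> strips this row from
  \<open>minor I\<close>. The cofactors of \<open>J\<close> are absorbed into \<open>F\<close> and
  the columns are relabelled, hence the induction is over all \<open>F\<close> and \<open>c\<close>.
  The quotient of the factorials is 1 / binomial(N - card I + card J, card J).\<close>

lemma integral_minor_minor:
  assumes F: "entry_poly N F" and I: "I \<subseteq> {..<N}" "J \<subseteq> I" and c: "c ` I \<subseteq> {..<N}" "inj_on c I"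
  shows "fact (N - card I + card J) *
      (\<integral>U. F U * minor J c (entries U) * cnj (minor I c (entries U)) \<partial>M) =
    fact (card J) * fact (N - card I) * (\<integral>U. F U * cnj (minor (I - J) c (entries U)) \<partial>M)"
  using assms
proof (induction "card J" arbitrary: J I c F)
  case 0
  hence "finite J" by (meson finite_lessThan finite_subset)
  hence "J = {}" using 0 by simp
  thus ?case by simp
next
  case (Suc n J I c F)
  let ?t = "\<lambda>a b. Transposition.transpose a b :: nat \<Rightarrow> nat"
  obtain a where a: "a \<in> J" using Suc.hyps(2) by (metis card_eq_SucD insertI1)
  have fin: "finite I" "finite J" using Suc.prems finite_subset by (blast, meson finite_lessThan finite_subset)
  have aI: "a \<in> I" using a Suc.prems by auto
  define k where "k = card I"
  have k: "1 \<le> k" "k \<le> N"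
    using aI fin(1) card_mono[OF finite_lessThan Suc.prems(2)] card_gt_0_iff[of I] by (auto simp: k_def)
  define X where "X = (\<integral>U. F U * cnj (minor (I - J) c (entries U)) \<partial>M)"
  let ?s = "\<lambda>b. of_int (sign (?t a b)) :: complex"
  let ?m = "\<lambda>b U. minor (J - {a}) (c \<circ> ?t a b) (entries U)"
  have img: "c b < N" "(c \<circ> ?t a b) ` (J - {a}) \<subseteq> {..<N}" "(c \<circ> ?t a b) ` (I - {a}) \<subseteq> {..<N}"
    if "b \<in> J" for b
  proof -
    have "c ` J \<subseteq> {..<N}" using Suc.prems by blast
    thus "(c \<circ> ?t a b) ` (J - {a}) \<subseteq> {..<N}" by (rule comp_transpose_image[OF _ a that])
    show "(c \<circ> ?t a b) ` (I - {a}) \<subseteq> {..<N}"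
      by (rule comp_transpose_image[OF Suc.prems(4) aI]) (use that Suc.prems in auto)
    show "c b < N" using Suc.prems that by auto
  qed
  have JN: "J - {a} \<subseteq> {..<N}" using Suc.prems by auto
  have epm: "entry_poly N (\<lambda>U. F U * ?m b U)" if "b \<in> J" for b
    using Suc.prems(1) JN img[OF that] by (intro entry_poly_mult entry_poly_minor)
  \<comment> \<open>One row is removed by the cofactor formula, the other \<open>n\<close> rows of
    \<open>J\<close> by the induction hypothesis for \<open>I - {a}\<close>, where
    \<open>N - card (I - {a}) = N + 1 - k\<close>.\<close>
  have main: "of_nat (N + 1 - k) * (fact (N - k + Suc n) *
      (\<integral>U. F U * ?m b U * U $$ (a, c b) * cnj (minor I c (entries U)) \<partial>M)) =
      ?s b * (fact n * fact (N + 1 - k) * X)" if b: "b \<in> J" for b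
  proof -
    have bI: "b \<in> I" using b Suc.prems by auto
    have "inj_on (c \<circ> ?t a b) I"
      by (rule comp_inj_on[OF permutes_inj_on[OF permutes_swap_id[OF aI bI]]])
         (simp add: permutes_image[OF permutes_swap_id[OF aI bI]] Suc.prems(5))
    hence inj: "inj_on (c \<circ> ?t a b) (I - {a})" by (rule inj_on_subset) auto
    have "fact (N - card (I - {a}) + card (J - {a})) *
        (\<integral>U. F U * ?m b U * cnj (minor (I - {a}) (c \<circ> ?t a b) (entries U)) \<partial>M) =
      fact (card (J - {a})) * fact (N - card (I - {a})) *
        (\<integral>U. F U * cnj (minor (I - {a} - (J - {a})) (c \<circ> ?t a b) (entries U)) \<partial>M)"
      by (rule Suc.hyps(1)) (use Suc.hyps(2) Suc.prems a fin img[OF b] inj in auto)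
    also have "N - card (I - {a}) + card (J - {a}) = N - k + Suc n"
      using k Suc.hyps(2) a aI fin by (simp add: k_def)
    also have "card (J - {a}) = n" using Suc.hyps(2) a fin by simp
    also have "N - card (I - {a}) = N + 1 - k" using k aI fin by (simp add: k_def)
    also have "I - {a} - (J - {a}) = I - J" using a by auto
    \<comment> \<open>The transposition moves only \<open>a\<close> and \<open>b\<close>, both in
      \<open>J\<close>, so all \<open>b\<close> lead to the same integral \<open>X\<close>.\<close>
    also have "(\<lambda>U. minor (I - J) (c \<circ> ?t a b) (entries U)) = (\<lambda>U. minor (I - J) c (entries U))"
      using a b by (intro ext minor_cong) (auto simp: Transposition.transpose_def)
    hence "(\<integral>U. F U * cnj (minor (I - J) (c \<circ> ?t a b) (entries U)) \<partial>M) = X"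
      unfolding X_def by (simp add: fun_eq_iff)
    finally have IH: "fact (N - k + Suc n) *
        (\<integral>U. F U * ?m b U * cnj (minor (I - {a}) (c \<circ> ?t a b) (entries U)) \<partial>M) =
      fact n * fact (N + 1 - k) * X" .
    from integral_cofactor[OF epm[OF b] Suc.prems(2) aI bI Suc.prems(4,5)]
    have "of_nat (N + 1 - k) * (\<integral>U. F U * ?m b U * U $$ (a, c b) * cnj (minor I c (entries U)) \<partial>M) =
      ?s b * (\<integral>U. F U * ?m b U * cnj (minor (I - {a}) (c \<circ> ?t a b) (entries U)) \<partial>M)"
      by (simp add: k_def)
    thus ?thesis unfolding IH[symmetric] by (metis (no_types, lifting) mult.left_commute)
  qed
  have bm: "bounded_measurable (\<lambda>U. F U * ?m b U * U $$ (a, c b) * cnj (minor I c (entries U)))" if "b \<in> J" for b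
    using epm[OF that] img[OF that] Suc.prems JN aI
    by (intro bounded_measurable_intros bounded_measurable_entry_poly[OF epm[OF that]]
          bounded_measurable_entry_poly[OF Suc.prems(1)]) auto
  have "(\<integral>U. F U * minor J c (entries U) * cnj (minor I c (entries U)) \<partial>M) =
      (\<integral>U. (\<Sum>b\<in>J. ?s b * (F U * ?m b U * U $$ (a, c b) * cnj (minor I c (entries U)))) \<partial>M)"
  proof (rule Bochner_Integration.integral_cong[OF refl])
    fix U
    show "F U * minor J c (entries U) * cnj (minor I c (entries U)) =
      (\<Sum>b\<in>J. ?s b * (F U * ?m b U * U $$ (a, c b) * cnj (minor I c (entries U))))"
      by (subst minor_expand[OF fin(2) a])
         (simp add: sum_distrib_left sum_distrib_right entries_def mult_ac)
  qed
  also have "\<dots> = (\<Sum>b\<in>J. ?s b * (\<integral>U. F U * ?m b U * U $$ (a, c b) * cnj (minor I c (entries U)) \<partial>M))"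
    by (subst Bochner_Integration.integral_sum)
       (auto intro!: bounded_measurable_integrable bounded_measurable_mult bounded_measurable_const bm)
  finally have "of_nat (N + 1 - k) * (fact (N - k + Suc n) *
      (\<integral>U. F U * minor J c (entries U) * cnj (minor I c (entries U)) \<partial>M)) =
      (\<Sum>b\<in>J. ?s b * (of_nat (N + 1 - k) * (fact (N - k + Suc n) *
        (\<integral>U. F U * ?m b U * U $$ (a, c b) * cnj (minor I c (entries U)) \<partial>M))))"
    by (simp add: sum_distrib_left mult.left_commute)
  also have "\<dots> = (\<Sum>b\<in>J. fact n * fact (N + 1 - k) * X)"
  proof (rule sum.cong[OF refl])
    fix b assume "b \<in> J"
    \<comment> \<open>The sign of the expansion and the sign of the cofactor formula agree. Hence
      all \<open>Suc n\<close> summands are equal, and \<open>Suc n\<close> turns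
      \<open>fact n\<close> into \<open>fact (Suc n)\<close>.\<close>
    have "?s b * ?s b = 1" by (simp add: sign_swap_id)
    thus "?s b * (of_nat (N + 1 - k) * (fact (N - k + Suc n) *
        (\<integral>U. F U * ?m b U * U $$ (a, c b) * cnj (minor I c (entries U)) \<partial>M))) =
        fact n * fact (N + 1 - k) * X"
      unfolding main[OF \<open>b \<in> J\<close>] by (simp only: mult.assoc[symmetric] mult_1)
  qed
  also have "\<dots> = of_nat (N + 1 - k) * (fact (Suc n) * fact (N - k) * X)"
  proof -
    have "fact (N + 1 - k) = (of_nat (N + 1 - k) * fact (N - k) :: complex)"
      using k by (simp add: Suc_diff_le)
    thus ?thesis by (simp add: Suc.hyps(2)[symmetric] fact_Suc mult_ac del: of_nat_Suc of_nat_diff)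
  qed
  finally have "fact (N - k + Suc n) *
      (\<integral>U. F U * minor J c (entries U) * cnj (minor I c (entries U)) \<partial>M) =
      fact (Suc n) * fact (N - k) * X"
    using k by (subst (asm) mult_cancel_left) (auto simp del: of_nat_diff)
  thus ?case by (simp only: k_def X_def Suc.hyps(2)[symmetric])
qed

text \<open>In terms of symmetric functions: the adjoint of multiplication by $e_j$ maps $e_k$ to $e_{k-j}$,
  up to terms orthogonal to all polynomials in the matrix entries.\<close>

lemma integral_esym_esym:
  assumes F: "entry_poly N F" and k: "k \<le> N"
  shows "(\<integral>U. F U * esym N j U * cnj (esym N k U) \<partial>M) =
    (if j \<le> k then (\<integral>U. F U * cnj (esym N (k - j) U) \<partial>M) else 0)"
proof -
  note bF = bounded_measurable_entry_poly[OF F]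
  define S where "S k = {I. I \<subseteq> {..<N} \<and> card I = k}" for k
  have finS: "finite (S k)" for k unfolding S_def by (rule finite_subset[of _ "Pow {..<N}"]) auto
  define X where "X K = (\<integral>U. F U * cnj (minor K id (entries U)) \<partial>M)" for K
  let ?E = "\<lambda>I J. \<integral>U. F U * minor J id (entries U) * cnj (minor I id (entries U)) \<partial>M"
  have es: "esym N k U = (\<Sum>I\<in>S k. minor I id (entries U))" for k U
    by (simp add: esym_def S_def)
  have X: "(\<integral>U. F U * cnj (esym N l U) \<partial>M) = sum X (S l)" for l
    unfolding es X_def sum_distrib_left cnj_sum
    by (intro Bochner_Integration.integral_sum bounded_measurable_integrable bounded_measurable_intros bF)
       (auto simp: S_def)
  \<comment> \<open>The reciprocal of the number of j-subsets \<open>J\<close> in the complement of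
    a set \<open>K\<close> of size k - j; this makes the coefficients cancel at the end.\<close>
  define r :: complex where "r = fact j * fact (N - k) / fact (N - k + j)"
  have E: "?E I J = (if J \<subseteq> I then r * X (I - J) else 0)" if IJ: "I \<in> S k" "J \<in> S j" for I J
  proof (cases "J \<subseteq> I")
    case True
    have "fact (N - k + j) * ?E I J = fact j * fact (N - k) * X (I - J)"
      using integral_minor_minor[OF F, of I J id] IJ True by (auto simp: S_def X_def)
    thus ?thesis using True by (simp add: r_def field_simps)
  next
    \<comment> \<open>Expanding \<open>minor J\<close> along a row \<open>a\<close> outside
      \<open>I\<close> leaves an entry in a row missing from \<open>minor I\<close>, so each term
      vanishes.\<close>
    case False
    then obtain a where a: "a \<in> J" "a \<notin> I" by auto
    have J: "finite J" "J \<subseteq> {..<N}" and I: "I \<subseteq> {..<N}" using IJ finite_subset by (auto simp: S_def)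
    have aN: "a < N" using a J by auto
    let ?m = "\<lambda>b U. minor (J - {a}) (id \<circ> Transposition.transpose a b) (entries U)"
    have img: "(id \<circ> Transposition.transpose a b) ` (J - {a}) \<subseteq> {..<N}" if "b \<in> J" for b
      by (rule comp_transpose_image[of id J]) (use J a that in auto)
    have ep: "entry_poly N (\<lambda>U. F U * ?m b U)" if "b \<in> J" for b
      using F J img[OF that] by (intro entry_poly_mult entry_poly_minor) auto
    have "?E I J = (\<integral>U. (\<Sum>b\<in>J. of_int (sign (Transposition.transpose a b)) *
        (F U * ?m b U * U $$ (a, b) * cnj (minor I id (entries U)))) \<partial>M)"
      by (subst minor_expand[OF J(1) a(1)])
         (simp add: sum_distrib_left sum_distrib_right entries_def mult_ac)
    also have "\<dots> = (\<Sum>b\<in>J. of_int (sign (Transposition.transpose a b)) *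
        (\<integral>U. F U * ?m b U * U $$ (a, b) * cnj (minor I id (entries U)) \<partial>M))"
    proof (subst Bochner_Integration.integral_sum)
      fix b assume b: "b \<in> J"
      have "b < N" using b J by auto
      thus "integrable M (\<lambda>U. of_int (sign (Transposition.transpose a b)) *
        (F U * ?m b U * U $$ (a, b) * cnj (minor I id (entries U))))"
        using aN I by (intro bounded_measurable_integrable bounded_measurable_mult bounded_measurable_const
          bounded_measurable_entry bounded_measurable_cnj bounded_measurable_minor
          bounded_measurable_entry_poly[OF ep[OF b, unfolded o_def]] bounded_measurable_entry_poly[OF ep[OF b]]) auto
    qed simp
    also have "\<dots> = 0"
      using J I a aN ep by (intro sum.neutral ballI) (subst integral_row_notin_eq_0, auto)
    finally show ?thesis using False by simp
  qed
  have "(\<integral>U. F U * esym N j U * cnj (esym N k U) \<partial>M) = (\<Sum>I\<in>S k. \<Sum>J\<in>S j. ?E I J)"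
  proof -
    have "(\<integral>U. F U * esym N j U * cnj (esym N k U) \<partial>M) =
        (\<integral>U. (\<Sum>I\<in>S k. \<Sum>J\<in>S j. F U * minor J id (entries U) * cnj (minor I id (entries U))) \<partial>M)"
      unfolding es cnj_sum sum_distrib_left sum_distrib_right by simp
    also have "\<dots> = (\<Sum>I\<in>S k. \<Sum>J\<in>S j. ?E I J)"
      by (subst Bochner_Integration.integral_sum;
          (intro sum.cong refl Bochner_Integration.integral_sum bounded_measurable_integrable
             bounded_measurable_intros bF)?) (auto simp: S_def)
    finally show ?thesis .
  qed
  also have "\<dots> = (\<Sum>I\<in>S k. \<Sum>J\<in>{J\<in>S j. J \<subseteq> I}. r * X (I - J))"
    using finS by (simp add: E sum.inter_filter)
  also have "\<dots> = (\<Sum>(I, J)\<in>Sigma (S k) (\<lambda>I. {J\<in>S j. J \<subseteq> I}). r * X (I - J))"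
    using finS by (subst sum.Sigma) auto
  also have "\<dots> = (if j \<le> k then (\<integral>U. F U * cnj (esym N (k - j) U) \<partial>M) else 0)"
  proof (cases "j \<le> k")
    case False
    have "{J\<in>S j. J \<subseteq> I} = {}" if "I \<in> S k" for I
      using that False card_mono[of I] finite_subset[of I "{..<N}"] by (fastforce simp: S_def)
    hence "Sigma (S k) (\<lambda>I. {J\<in>S j. J \<subseteq> I}) = {}" by blast
    thus ?thesis using False by simp
  next
    case True
    \<comment> \<open>Pairs \<open>J\<close> inside \<open>I\<close> are reparametrised by
      \<open>K = I - J\<close> and \<open>J\<close>, since the summand depends on \<open>K\<close>
      only.\<close>
    have "(\<Sum>(I, J)\<in>Sigma (S k) (\<lambda>I. {J\<in>S j. J \<subseteq> I}). r * X (I - J)) =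
        (\<Sum>(K, J)\<in>Sigma (S (k - j)) (\<lambda>K. {J. J \<subseteq> {..<N} - K \<and> card J = j}). r * X K)"
    proof (rule sum.reindex_bij_witness[where i = "\<lambda>(K, J). (K \<union> J, J)" and j = "\<lambda>(I, J). (I - J, J)"], goal_cases)
      case (2 x) thus ?case
        using True by (auto simp: S_def card_Diff_subset finite_subset[OF _ finite_lessThan])
    next
      case (4 x) 
      obtain K J where x: "x = (K, J)" by (cases x)
      have "K \<subseteq> {..<N}" "J \<subseteq> {..<N} - K" "card K = k - j" "card J = j" using 4 by (auto simp: x S_def)
      moreover from this have "finite K" "finite J" "K \<inter> J = {}" 
        by (meson finite_lessThan finite_subset finite_Diff, meson finite_lessThan finite_subset finite_Diff, blast)
      ultimately show ?case using True by (auto simp: S_def x card_Un_disjoint)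
    qed (auto simp: S_def)
    also have "\<dots> = (\<Sum>K\<in>S (k - j). \<Sum>J\<in>{J. J \<subseteq> {..<N} - K \<and> card J = j}. r * X K)"
      using finS by (subst sum.Sigma) (auto intro: finite_subset[of _ "Pow {..<N}"])
    also have "\<dots> = (\<Sum>K\<in>S (k - j). X K)"
    proof (rule sum.cong[OF refl])
      fix K assume K: "K \<in> S (k - j)"
      hence "card ({..<N} - K) = N - k + j"
        using True k finite_subset[OF _ finite_lessThan, of K N] by (simp add: S_def card_Diff_subset)
      hence "card {J. J \<subseteq> {..<N} - K \<and> card J = j} = (N - k + j) choose j"
        by (subst n_subsets) auto
      moreover have "of_nat ((N - k + j) choose j) * r = 1"
        by (simp add: r_def binomial_fact)
      ultimately show "(\<Sum>J\<in>{J. J \<subseteq> {..<N} - K \<and> card J = j}. r * X K) = X K"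
        by (simp add: mult.assoc[symmetric])
    qed
    finally show ?thesis using True by (simp add: X)
  qed
  finally show ?thesis .
qed

text \<open>The initial values for the recursion in \<open>integral_secular_resolvent_esym\<close>.
  A minor of positive size has degree 1 in some row, the constant 1 has degree 0.\<close>

lemma integral_cnj_esym: "(\<integral>U. cnj (esym N k U) \<partial>M) = (if k = 0 then 1 else 0)"
proof (cases "k = 0")
  case False
  show ?thesis
  proof (cases "k \<le> N")
    case True
    have "(\<integral>U. cnj (minor I id (entries U)) \<partial>M) = 0" if I: "I \<subseteq> {..<N}" "card I = k" for I
    proof -
      obtain a where "a \<in> I" using I False by (metis card.empty equals0I)
      thus ?thesis
        using integral_monomial_minor_eq_0[of "[]" I id a] I by (auto simp: monomial_def)
    qed
    thus ?thesis using False unfolding esym_def cnj_sum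
      by (subst Bochner_Integration.integral_sum)
         (auto intro!: bounded_measurable_integrable bounded_measurable_cnj bounded_measurable_minor sum.neutral)
  qed (simp add: esym_eq_0 False)
qed (simp add: prob_space)

end

section \<open>Eigenvalues\<close>

text \<open>\<open>secular N r U\<close> is $\det(1 - rU)$, and \<open>resolvent_trace N r U\<close> is the trace of $rU(1 - rU)^{-1}$.
  The junk value \<open>0\<close> of the latter at a zero of the former is harmless, because it only ever
  occurs multiplied by \<open>secular\<close>.\<close>

definition secular :: "nat \<Rightarrow> complex \<Rightarrow> complex mat \<Rightarrow> complex" where
  "secular N r U = (\<Sum>k\<le>N. (- r) ^ k * esym N k U)"

definition resolvent_trace :: "nat \<Rightarrow> complex \<Rightarrow> complex mat \<Rightarrow> complex" where
  "resolvent_trace N r U = - (\<Sum>k\<le>N. of_nat k * (- r) ^ k * esym N k U) / secular N r U"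

abbreviation eigenvalues :: "complex mat \<Rightarrow> complex multiset" where
  "eigenvalues U \<equiv> proots (char_poly U)"

text \<open>In the Leibniz formula for det(x - U) each factor is the sum of an entry of -U and of x
  on the diagonal. Choosing entries of -U on the rows in \<open>X\<close> and x on the others forces
  the permutation to fix the complement of \<open>X\<close>, which leaves the principal minor on
  \<open>X\<close>.\<close>

lemma poly_char_poly_minors:
  assumes U: "U \<in> carrier_mat N N"
  shows "poly (char_poly U) x = (\<Sum>k\<le>N. (-1) ^ k * x ^ (N - k) * esym N k U)"
proof -
  let ?A = "- char_matrix U x"
  let ?P = "{p. p permutes {..<N}}"
  have "poly (char_poly U) x = Determinant.det ?A" by (rule char_poly_matrix[OF U])
  also have "\<dots> = (\<Sum>p\<in>?P. of_int (sign p) * (\<Prod>i<N. ?A $$ (i, p i)))"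
    using U by (subst det_def'[of _ N]) (auto simp: lessThan_atLeast0 char_matrix_def)
  also have "\<dots> = (\<Sum>p\<in>?P. of_int (sign p) * (\<Prod>i<N. - entries U i (p i) + (if p i = i then x else 0)))"
  proof (intro sum.cong refl arg_cong2[of _ _ _ _ "(*)"] prod.cong)
    fix p i assume "p \<in> ?P" "i \<in> {..<N}"
    hence "i < N" "p i < N" using permutes_in_image[of p "{..<N}" i] by auto
    thus "?A $$ (i, p i) = - entries U i (p i) + (if p i = i then x else 0)"
      using U by (auto simp: char_matrix_def entries_def)
  qed
  also have "\<dots> = (\<Sum>p\<in>?P. \<Sum>X\<in>Pow {..<N}. of_int (sign p) *
      ((\<Prod>i\<in>X. - entries U i (p i)) * (\<Prod>i\<in>{..<N} - X. if p i = i then x else 0)))"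
    by (subst prod_add) (simp_all add: sum_distrib_left)
  also have "\<dots> = (\<Sum>X\<in>Pow {..<N}. \<Sum>p\<in>?P. of_int (sign p) *
      ((\<Prod>i\<in>X. - entries U i (p i)) * (\<Prod>i\<in>{..<N} - X. if p i = i then x else 0)))"
    by (rule sum.swap)
  also have "\<dots> = (\<Sum>X\<in>Pow {..<N}. (-1) ^ card X * x ^ (N - card X) * minor X id (entries U))"
  proof (rule sum.cong[OF refl])
    fix X assume X: "X \<in> Pow {..<N}"
    have fX: "finite X" using X finite_subset by auto
    have "(\<Sum>p\<in>?P. of_int (sign p) *
        ((\<Prod>i\<in>X. - entries U i (p i)) * (\<Prod>i\<in>{..<N} - X. if p i = i then x else 0))) =
      (\<Sum>p | p permutes X. of_int (sign p) *
        ((\<Prod>i\<in>X. - entries U i (p i)) * (\<Prod>i\<in>{..<N} - X. if p i = i then x else 0)))"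
    proof (rule sum.mono_neutral_right)
      show "finite ?P" by (intro finite_permutations) simp
      show "{p. p permutes X} \<subseteq> ?P" using X by (auto intro: permutes_subset)
      show "\<forall>p\<in>?P - {p. p permutes X}. of_int (sign p) *
        ((\<Prod>i\<in>X. - entries U i (p i)) * (\<Prod>i\<in>{..<N} - X. if p i = i then x else 0)) = 0"
      proof
        fix p assume p: "p \<in> ?P - {p. p permutes X}"
        have "\<exists>i\<in>{..<N} - X. p i \<noteq> i"
        proof (rule ccontr)
          assume "\<not> ?thesis"
          hence fixed: "\<And>i. i \<in> {..<N} - X \<Longrightarrow> p i = i" by blast
          have "p permutes {..<N}" using p by simp
          hence "p permutes X" by (rule permutes_superset) (rule fixed)
          thus False using p by simp
        qed
        then obtain i where "i \<in> {..<N} - X" "p i \<noteq> i" by blast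
        hence "(\<Prod>i\<in>{..<N} - X. if p i = i then x else 0) = 0" by (intro prod_zero bexI[of _ i]) auto
        thus "of_int (sign p) * ((\<Prod>i\<in>X. - entries U i (p i)) *
            (\<Prod>i\<in>{..<N} - X. if p i = i then x else 0)) = 0"
          by simp
      qed
    qed
    also have "\<dots> = (\<Sum>p | p permutes X. of_int (sign p) *
        (((-1) ^ card X * (\<Prod>i\<in>X. entries U i (p i))) * x ^ (N - card X)))"
    proof (intro sum.cong refl arg_cong2[of _ _ _ _ "(*)"])
      fix p assume p: "p \<in> {p. p permutes X}"
      have "(\<Prod>i\<in>{..<N} - X. if p i = i then x else 0) = (\<Prod>i\<in>{..<N} - X. x)"
        using p by (intro prod.cong) (auto simp: permutes_def)
      thus "(\<Prod>i\<in>{..<N} - X. if p i = i then x else 0) = x ^ (N - card X)"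
        using X fX by (simp add: card_Diff_subset)
      show "(\<Prod>i\<in>X. - entries U i (p i)) = (-1) ^ card X * (\<Prod>i\<in>X. entries U i (p i))"
        by (simp add: prod_uminus)
    qed
    also have "\<dots> = (-1) ^ card X * x ^ (N - card X) * minor X id (entries U)"
      by (simp add: minor_def sum_distrib_left mult_ac)
    finally show "(\<Sum>p\<in>?P. of_int (sign p) *
        ((\<Prod>i\<in>X. - entries U i (p i)) * (\<Prod>i\<in>{..<N} - X. if p i = i then x else 0))) =
      (-1) ^ card X * x ^ (N - card X) * minor X id (entries U)" .
  qed
  also have "\<dots> = (\<Sum>k\<le>N. \<Sum>X\<in>{X \<in> Pow {..<N}. card X = k}.
      (-1) ^ card X * x ^ (N - card X) * minor X id (entries U))"
    by (rule sum.group[symmetric]) (auto dest: card_mono[rotated])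
  also have "\<dots> = (\<Sum>k\<le>N. (-1) ^ k * x ^ (N - k) * esym N k U)"
    unfolding esym_def sum_distrib_left by (intro sum.cong) auto
  finally show ?thesis .
qed

lemma eigenvalues_size: "U \<in> carrier_mat N N \<Longrightarrow> size (eigenvalues U) = N"
  by (simp add: size_proots_complex degree_monic_char_poly)

text \<open>For r different from 0 both sides are r^N times the characteristic polynomial at 1 /
  r.\<close>

lemma secular_eq_prod:
  assumes U: "U \<in> carrier_mat N N"
  shows "secular N r U = (\<Prod>z\<in>#eigenvalues U. 1 - r * z)"
proof (cases "r = 0")
  case True
  have "(\<Sum>k\<le>N. (0 :: complex) ^ k * esym N k U) = (\<Sum>k\<le>N. if k = 0 then 1 else 0)"
    by (intro sum.cong) auto
  thus ?thesis using True by (simp add: secular_def)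
next
  case False
  have prod_scale: "(\<Prod>z\<in>#A. 1 - r * z) = r ^ size A * (\<Prod>z\<in>#A. 1 / r - z)" for A
    using False by (induction A) (auto simp: field_simps)
  have "poly (\<Prod>x\<in>#eigenvalues U. [:- x, 1:]) (1 / r) = (\<Prod>z\<in>#eigenvalues U. 1 / r - z)"
    by (simp add: poly_prod_mset image_mset.compositionality o_def)
  moreover have "(\<Prod>x\<in>#eigenvalues U. [:- x, 1:]) = char_poly U"
    using complex_poly_decompose_multiset[of "char_poly U"] degree_monic_char_poly[OF U] by simp
  ultimately have "(\<Prod>z\<in>#eigenvalues U. 1 - r * z) = r ^ N * poly (char_poly U) (1 / r)"
    by (simp add: prod_scale eigenvalues_size[OF U])
  also have "\<dots> = (\<Sum>k\<le>N. r ^ N * ((-1) ^ k * (1 / r) ^ (N - k) * esym N k U))"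
    by (simp add: poly_char_poly_minors[OF U] sum_distrib_left)
  also have "\<dots> = (\<Sum>k\<le>N. (- r) ^ k * esym N k U)"
  proof (rule sum.cong[OF refl])
    fix k assume "k \<in> {..N}"
    hence "r ^ N = r ^ k * r ^ (N - k)" by (simp add: power_add[symmetric])
    thus "r ^ N * ((-1) ^ k * (1 / r) ^ (N - k) * esym N k U) = (- r) ^ k * esym N k U"
      using False by (simp add: power_minus[of r] power_divide)
  qed
  finally show ?thesis by (simp add: secular_def)
qed

text \<open>Orthonormal columns make \<open>U\<close> preserve the norm of an eigenvector.\<close>

lemma eigenvalue_unitary_norm:
  assumes U: "U \<in> unitary_group N" and z: "z \<in># eigenvalues U"
  shows "cmod z = 1"
proof -
  have Uc: "U \<in> carrier_mat N N" using U by (simp add: unitary_group_def)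
  have "char_poly U \<noteq> 0" using degree_monic_char_poly[OF Uc] by auto
  hence "poly (char_poly U) z = 0" using z by simp
  hence "eigenvalue U z" by (simp add: eigenvalue_root_char_poly[OF Uc])
  then obtain v where v: "v \<in> carrier_vec N" "v \<noteq> 0\<^sub>v N" "U *\<^sub>v v = z \<cdot>\<^sub>v v"
    using Uc by (auto simp: eigenvalue_def eigenvector_def)
  have Uv: "(\<Sum>j<N. U $$ (i, j) * v $ j) = z * v $ i" if "i < N" for i
  proof -
    have "(U *\<^sub>v v) $ i = (\<Sum>j<N. U $$ (i, j) * v $ j)"
      using that Uc v(1) by (auto simp: scalar_prod_def lessThan_atLeast0 intro!: sum.cong)
    thus ?thesis using v that by auto
  qed
  have "complex_of_real (\<Sum>i<N. (cmod (z * v $ i))\<^sup>2) =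
      (\<Sum>i<N. (\<Sum>j<N. U $$ (i, j) * v $ j) * cnj (\<Sum>k<N. U $$ (i, k) * v $ k))"
    unfolding of_real_sum complex_norm_square by (intro sum.cong refl) (simp add: Uv)
  also have "\<dots> = (\<Sum>i<N. \<Sum>j<N. \<Sum>k<N. v $ j * cnj (v $ k) * (U $$ (i, j) * cnj (U $$ (i, k))))"
    by (simp add: sum_product mult_ac)
  also have "\<dots> = (\<Sum>j<N. \<Sum>k<N. \<Sum>i<N. v $ j * cnj (v $ k) * (U $$ (i, j) * cnj (U $$ (i, k))))"
    by (rule trans[OF sum.swap], rule sum.cong[OF refl], rule sum.swap)
  also have "\<dots> = (\<Sum>j<N. \<Sum>k<N. v $ j * cnj (v $ k) * (if j = k then 1 else 0))"
    by (intro sum.cong refl) (simp only: sum_distrib_left[symmetric] unitary_group_columns[OF U] lessThan_iff)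
  also have "\<dots> = (\<Sum>j<N. v $ j * cnj (v $ j))"
    by (simp add: if_distrib cong: if_cong)
  also have "\<dots> = complex_of_real (\<Sum>i<N. (cmod (v $ i))\<^sup>2)"
    unfolding of_real_sum complex_norm_square ..
  finally have "(\<Sum>i<N. (cmod (z * v $ i))\<^sup>2) = (\<Sum>i<N. (cmod (v $ i))\<^sup>2)"
    by (simp only: of_real_eq_iff)
  hence eq: "(cmod z)\<^sup>2 * (\<Sum>i<N. (cmod (v $ i))\<^sup>2) = (\<Sum>i<N. (cmod (v $ i))\<^sup>2)"
    by (simp add: norm_mult power_mult_distrib sum_distrib_left)
  obtain i where i: "i < N" "v $ i \<noteq> 0" using v by (metis carrier_vecD eq_vecI index_zero_vec)
  have "(\<Sum>i<N. (cmod (v $ i))\<^sup>2) > 0"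
    using i by (intro sum_pos2[of _ i]) auto
  hence "(cmod z)\<^sup>2 = 1" using eq by simp
  thus ?thesis by (metis norm_ge_zero power2_eq_1_iff neg_0_le_iff_le not_one_le_zero)
qed

text \<open>Newton's identities as an equation of generating functions.\<close>

lemma prod_mset_deriv_fps:
  fixes A :: "complex multiset"
  defines "P \<equiv> (\<Prod>z\<in>#A. 1 - fps_const z * fps_X)"
  defines "T \<equiv> Abs_fps (\<lambda>m. if m = 0 then 0 else \<Sum>z\<in>#A. z ^ m)"
  shows "P * T = - fps_X * fps_deriv P"
  unfolding P_def T_def
proof (induction A)
  case (add a A)
  let ?P = "\<Prod>z\<in>#A. 1 - fps_const z * fps_X"
  let ?T = "Abs_fps (\<lambda>m. if m = 0 then 0 else \<Sum>z\<in>#A. z ^ m)"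
  let ?Z = "Abs_fps (\<lambda>m. if m = 0 then 0 else a ^ m)"
  have "Abs_fps (\<lambda>m. if m = 0 then 0 else \<Sum>z\<in>#add_mset a A. z ^ m) = ?Z + ?T"
    by (intro fps_ext) auto
  moreover have "(1 - fps_const a * fps_X) * ?Z = fps_const a * fps_X"
  proof (rule fps_ext)
    fix n show "fps_nth ((1 - fps_const a * fps_X) * ?Z) n = fps_nth (fps_const a * fps_X) n"
      by (cases n) (auto simp: ring_distribs mult.assoc)
  qed
  moreover have "fps_deriv (\<Prod>z\<in>#add_mset a A. 1 - fps_const z * fps_X) =
      (1 - fps_const a * fps_X) * fps_deriv ?P - fps_const a * ?P"
    by (simp add: algebra_simps)
  moreover have "(\<Prod>z\<in>#add_mset a A. 1 - fps_const z * fps_X) = (1 - fps_const a * fps_X) * ?P" by simp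
  moreover have "(1 - fps_const a * fps_X) * ?P * (?Z + ?T) =
      ?P * ((1 - fps_const a * fps_X) * ?Z) + (1 - fps_const a * fps_X) * (?P * ?T)"
    by (simp add: algebra_simps)
  moreover have "?P * (c * fps_X) + (1 - c * fps_X) * (- fps_X * fps_deriv ?P) =
      - fps_X * ((1 - c * fps_X) * fps_deriv ?P - c * ?P)" for c
    by (simp add: algebra_simps)
  ultimately show ?case by (simp only: add)
qed (simp add: fps_ext)

lemma prod_eigenvalues_eq_poly:
  assumes U: "U \<in> carrier_mat N N"
  shows "(\<Prod>z\<in>#eigenvalues U. [:1, -z:]) = (\<Sum>k\<le>N. monom ((-1) ^ k * esym N k U) k)"
proof -
  have "poly (\<Prod>z\<in>#eigenvalues U. [:1, -z:]) r = poly (\<Sum>k\<le>N. monom ((-1) ^ k * esym N k U) k) r" for r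
  proof -
    have "poly (\<Prod>z\<in>#eigenvalues U. [:1, -z:]) r = (\<Prod>z\<in>#eigenvalues U. 1 - r * z)"
      by (simp add: poly_prod_mset image_mset.compositionality o_def)
    also have "\<dots> = secular N r U" by (rule secular_eq_prod[OF U, symmetric])
    also have "\<dots> = poly (\<Sum>k\<le>N. monom ((-1) ^ k * esym N k U) k) r"
      by (simp add: secular_def poly_sum poly_monom power_minus[of r] mult_ac)
    finally show ?thesis .
  qed
  thus ?thesis by (subst poly_eq_poly_eq_iff[symmetric]) (rule ext)
qed

lemma fps_nth_prod_eigenvalues:
  assumes U: "U \<in> carrier_mat N N"
  shows "fps_nth (\<Prod>z\<in>#eigenvalues U. 1 - fps_const z * fps_X) n = (-1) ^ n * esym N n U"
proof -
  have "fps_of_poly (\<Prod>z\<in>#A. [:1, -z:]) = (\<Prod>z\<in>#A. 1 - fps_const z * fps_X)" for A :: "complex multiset"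
    by (induction A) (auto simp: fps_of_poly_mult fps_of_poly_linear simp del: mult_pCons_left)
  hence "fps_nth (\<Prod>z\<in>#eigenvalues U. 1 - fps_const z * fps_X) n =
      fps_nth (fps_of_poly (\<Prod>z\<in>#eigenvalues U. [:1, -z:])) n" by simp
  also have "\<dots> = coeff (\<Sum>k\<le>N. monom ((-1) ^ k * esym N k U) k) n"
    by (simp only: fps_of_poly_nth prod_eigenvalues_eq_poly[OF U])
  also have "\<dots> = (\<Sum>k\<le>N. if k = n then (-1) ^ k * esym N k U else 0)"
    by (simp add: coeff_sum coeff_monom)
  also have "\<dots> = (-1) ^ n * esym N n U" by (auto simp: esym_eq_0)
  finally show ?thesis .
qed

text \<open>Newton's identity, solved for the highest power sum, expresses it by the lower ones and
  the elementary symmetric functions. This is what makes the partial sums of the series for T(r)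
  admissible as \<open>F\<close> in \<open>integral_esym_esym\<close>.\<close>

lemma entry_poly_power_sum:
  "\<exists>F. entry_poly N F \<and> (\<forall>U\<in>unitary_group N. (\<Sum>z\<in>#eigenvalues U. z ^ Suc m) = F U)"
proof (induction m rule: less_induct)
  case (less m)
  then obtain F where F: "\<And>l. l < m \<Longrightarrow> entry_poly N (F l)"
    "\<And>l U. l < m \<Longrightarrow> U \<in> unitary_group N \<Longrightarrow> (\<Sum>z\<in>#eigenvalues U. z ^ Suc l) = F l U"
    by metis
  define G where "G U = - (of_nat (Suc m) * ((-1) ^ Suc m * esym N (Suc m) U)) -
      (\<Sum>l<m. ((-1) ^ (m - l) * esym N (m - l) U) * F l U)" for U
  have "entry_poly N (\<lambda>U. (- (of_nat (Suc m) * (-1) ^ Suc m)) * esym N (Suc m) U +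
      (\<Sum>l<m. (- ((-1) ^ (m - l)) * esym N (m - l) U) * F l U))"
    by (intro entry_poly_add entry_poly_mult entry_poly_const entry_poly_sum entry_poly_esym F(1)) auto
  also have "(\<lambda>U. (- (of_nat (Suc m) * (-1) ^ Suc m)) * esym N (Suc m) U +
      (\<Sum>l<m. (- ((-1) ^ (m - l)) * esym N (m - l) U) * F l U)) = G"
    by (simp add: fun_eq_iff G_def sum_negf)
  finally have "entry_poly N G" .
  moreover have "(\<Sum>z\<in>#eigenvalues U. z ^ Suc m) = G U" if U: "U \<in> unitary_group N" for U
  proof -
    have Uc: "U \<in> carrier_mat N N" using U by (simp add: unitary_group_def)
    let ?P = "\<Prod>z\<in>#eigenvalues U. 1 - fps_const z * fps_X"
    let ?T = "Abs_fps (\<lambda>m. if m = 0 then 0 else \<Sum>z\<in>#eigenvalues U. z ^ m)"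
    have nth: "fps_nth ?P n = (-1) ^ n * esym N n U" for n by (rule fps_nth_prod_eigenvalues[OF Uc])
    have "fps_nth (?T * ?P) (Suc m) = fps_nth (- fps_X * fps_deriv ?P) (Suc m)"
      using prod_mset_deriv_fps[of "eigenvalues U"] by (simp only: mult.commute)
    also have "fps_nth (- fps_X * fps_deriv ?P) (Suc m) = - (of_nat (Suc m) * fps_nth ?P (Suc m))"
      by simp
    also have "fps_nth (?T * ?P) (Suc m) = (\<Sum>i\<in>{0..Suc m}. fps_nth ?T i * fps_nth ?P (Suc m - i))"
      by (rule fps_mult_nth)
    also have "\<dots> = (\<Sum>l\<in>{0..m}. fps_nth ?T (Suc l) * fps_nth ?P (m - l))"
      by (subst sum.atLeast0_atMost_Suc_shift) simp
    also have "\<dots> = (\<Sum>l<m. fps_nth ?T (Suc l) * fps_nth ?P (m - l)) + fps_nth ?T (Suc m) * fps_nth ?P 0"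
      by (simp add: atLeast0AtMost lessThan_Suc_atMost[symmetric])
    also have "(\<Sum>l<m. fps_nth ?T (Suc l) * fps_nth ?P (m - l)) =
        (\<Sum>l<m. F l U * ((-1) ^ (m - l) * esym N (m - l) U))"
      by (intro sum.cong refl) (simp add: nth F(2)[OF _ U, symmetric])
    finally show ?thesis by (simp add: nth G_def eq_diff_eq add.commute mult.commute[of "F _ _"])
  qed
  ultimately show ?case by blast
qed

text \<open>The logarithmic derivative -r Z'(r) / Z(r) of the product over the eigenvalues. The
  differentiation is that of polynomials, done once for the product and once for its
  coefficients.\<close>

lemma resolvent_trace_eq_sum:
  assumes U: "U \<in> carrier_mat N N" and nz: "\<And>z. z \<in># eigenvalues U \<Longrightarrow> r * z \<noteq> 1"
  shows "resolvent_trace N r U = (\<Sum>z\<in>#eigenvalues U. r * z / (1 - r * z))"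
proof -
  have deriv: "r * poly (pderiv (\<Prod>z\<in>#A. [:1, -z:])) r =
      - (\<Prod>z\<in>#A. 1 - r * z) * (\<Sum>z\<in>#A. r * z / (1 - r * z))"
    if "\<And>z. z \<in># A \<Longrightarrow> r * z \<noteq> 1" for A
    using that
  proof (induction A)
    case (add a A)
    let ?p = "\<Prod>z\<in>#A. 1 - r * z" and ?d = "poly (pderiv (\<Prod>z\<in>#A. [:1, -z:])) r"
      and ?s = "\<Sum>z\<in>#A. r * z / (1 - r * z)" and ?q = "r * a / (1 - r * a)"
    have q: "(1 - r * a) * ?q = r * a" using add.prems by simp
    have IH: "r * ?d = - ?p * ?s" by (rule add.IH) (use add.prems in simp)
    have "poly (\<Prod>z\<in>#A. [:1, -z:]) r = ?p"
      by (simp add: poly_prod_mset image_mset.compositionality o_def)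
    hence "poly (pderiv (\<Prod>z\<in>#add_mset a A. [:1, -z:])) r = (1 - r * a) * ?d + ?p * (- a)"
      by (simp add: pderiv_mult pderiv_pCons del: mult_pCons_left)
    hence "r * poly (pderiv (\<Prod>z\<in>#add_mset a A. [:1, -z:])) r = (1 - r * a) * (r * ?d) - ?p * (r * a)"
      by (simp only:) (simp only: ring_distribs mult_ac mult_minus_right mult_minus_left diff_conv_add_uminus)
    also have "\<dots> = (1 - r * a) * (- ?p * ?s) - ?p * ((1 - r * a) * ?q)" by (simp only: IH q)
    also have "\<dots> = - ((1 - r * a) * ?p) * (?q + ?s)"
      by (simp only: ring_distribs mult_ac mult_minus_right mult_minus_left diff_conv_add_uminus minus_add_distrib add_ac)
    finally show ?case by simp
  qed simp
  have "r * poly (pderiv (\<Sum>k\<le>N. monom ((-1) ^ k * esym N k U) k)) r =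
      (\<Sum>k\<le>N. of_nat k * (- r) ^ k * esym N k U)"
    unfolding pderiv_sum poly_sum sum_distrib_left
  proof (rule sum.cong[OF refl])
    fix k
    show "r * poly (pderiv (monom ((-1) ^ k * esym N k U) k)) r = of_nat k * (- r) ^ k * esym N k U"
      by (cases k) (auto simp: pderiv_monom poly_monom power_minus[of r])
  qed
  moreover have "r * poly (pderiv (\<Prod>z\<in>#eigenvalues U. [:1, -z:])) r =
      - secular N r U * (\<Sum>z\<in>#eigenvalues U. r * z / (1 - r * z))"
    using deriv[OF nz] secular_eq_prod[OF U] by simp
  moreover have "secular N r U \<noteq> 0"
    using nz by (auto simp: secular_eq_prod[OF U] prod_mset_zero_iff)
  moreover have "- (- s * t) / s = t" if "s \<noteq> 0" for s t :: complex using that by simp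
  ultimately show ?thesis
    by (simp only: resolvent_trace_def prod_eigenvalues_eq_poly[OF U] if_True not_False_eq_True)
qed

lemma secular_nonzero_iff:
  "U \<in> carrier_mat N N \<Longrightarrow> secular N r U \<noteq> 0 \<longleftrightarrow> (\<forall>z. z \<in># eigenvalues U \<longrightarrow> r * z \<noteq> 1)"
  by (auto simp: secular_eq_prod prod_mset_zero_iff)

lemma norm_secular_le:
  assumes U: "U \<in> unitary_group N" and r: "cmod r \<le> 1"
  shows "cmod (secular N r U) \<le> 2 ^ N"
proof -
  have Uc: "U \<in> carrier_mat N N" using U by (simp add: unitary_group_def)
  have "cmod (\<Prod>z\<in>#A. 1 - r * z) \<le> 2 ^ size A" if "\<And>z. z \<in># A \<Longrightarrow> cmod z = 1" for A
    using that
  proof (induction A)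
    case (add a A)
    have "cmod (1 - r * a) \<le> 1 + cmod (r * a)" by (metis norm_one norm_triangle_ineq4)
    also have "\<dots> \<le> 2" using r add.prems[of a] by (simp add: norm_mult)
    finally show ?case using add by (auto simp: norm_mult intro!: mult_mono)
  qed simp
  from this[of "eigenvalues U"] show ?thesis
    using eigenvalue_unitary_norm[OF U] by (simp add: secular_eq_prod[OF Uc] eigenvalues_size[OF Uc])
qed

text \<open>Here w / (1 - w) = -1/2 + (1 + w) / (2 (1 - w)), and the Cayley transform maps the unit
  disc to the right half-plane and the circle to its boundary.\<close>

lemma Re_geometric_ge:
  assumes "cmod w \<le> 1" "w \<noteq> 1"
  shows "Re (w / (1 - w)) \<ge> - 1 / 2" "cmod w = 1 \<Longrightarrow> Re (w / (1 - w)) = - 1 / 2"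
proof -
  have pos: "(cmod (1 - w))\<^sup>2 > 0" using assms by simp
  have eq: "Re (w / (1 - w)) = (Re w - (cmod w)\<^sup>2) / (cmod (1 - w))\<^sup>2"
    unfolding Re_divide' cmod_power2 by (simp add: power2_eq_square algebra_simps)
  have n: "(cmod (1 - w))\<^sup>2 = 1 - 2 * Re w + (cmod w)\<^sup>2"
    unfolding cmod_power2 by (simp add: power2_eq_square algebra_simps)
  have "(cmod w)\<^sup>2 \<le> 1" using assms by (simp add: power_le_one)
  thus "Re (w / (1 - w)) \<ge> - 1 / 2"
    unfolding eq pos_le_divide_eq[OF pos] unfolding n by (simp add: field_simps)
  assume "cmod w = 1"
  thus "Re (w / (1 - w)) = - 1 / 2"
    unfolding eq using pos by (subst divide_eq_eq) (auto simp add: n field_simps)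
qed

lemma Re_sum_mset: "Re (\<Sum>z\<in>#A. f z) = (\<Sum>z\<in>#A. Re (f z))"
  by (induction A) auto

text \<open>The inequality bounds exp(-2 s T(r)) uniformly in r; the equality on the circle makes
  T(1) + N/2 purely imaginary, which is where the cosine comes from.\<close>

lemma Re_resolvent_trace_ge:
  assumes U: "U \<in> unitary_group N" and r: "cmod r \<le> 1" and nz: "secular N r U \<noteq> 0"
  shows "Re (resolvent_trace N r U) \<ge> - real N / 2"
    "cmod r = 1 \<Longrightarrow> Re (resolvent_trace N r U) = - real N / 2"
proof -
  have Uc: "U \<in> carrier_mat N N" using U by (simp add: unitary_group_def)
  let ?S = "eigenvalues U"
  have nz': "r * z \<noteq> 1" "cmod (r * z) \<le> 1" "cmod r = 1 \<Longrightarrow> cmod (r * z) = 1" if "z \<in># ?S" for z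
    using nz r that eigenvalue_unitary_norm[OF U that] by (auto simp: secular_nonzero_iff[OF Uc] norm_mult)
  have eq: "Re (resolvent_trace N r U) = (\<Sum>z\<in>#?S. Re (r * z / (1 - r * z)))"
    using nz' by (simp add: resolvent_trace_eq_sum[OF Uc] Re_sum_mset del: Re_divide)
  have "(\<Sum>z\<in>#?S. - 1 / 2 :: real) \<le> (\<Sum>z\<in>#?S. Re (r * z / (1 - r * z)))"
    using nz' Re_geometric_ge(1) by (intro sum_mset_mono) blast
  thus "Re (resolvent_trace N r U) \<ge> - real N / 2"
    by (simp add: eq eigenvalues_size[OF Uc])
  assume "cmod r = 1"
  hence "(\<Sum>z\<in>#?S. Re (r * z / (1 - r * z))) = (\<Sum>z\<in>#?S. - 1 / 2 :: real)"
    using nz' Re_geometric_ge(2) by (intro arg_cong[of _ _ sum_mset] image_mset_cong) blast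
  thus "Re (resolvent_trace N r U) = - real N / 2"
    by (simp add: eq eigenvalues_size[OF Uc])
qed

lemma secular_nonzero:
  assumes U: "U \<in> unitary_group N" and r: "cmod r < 1"
  shows "secular N r U \<noteq> 0"
proof -
  have Uc: "U \<in> carrier_mat N N" using U by (simp add: unitary_group_def)
  have "r * z \<noteq> 1" if "z \<in># eigenvalues U" for z
  proof
    assume "r * z = 1"
    hence "cmod r * cmod z = 1" by (metis norm_mult norm_one)
    thus False using r eigenvalue_unitary_norm[OF U that] by simp
  qed
  thus ?thesis by (simp add: secular_nonzero_iff[OF Uc])
qed

text \<open>Geometric series in each r z, summed over the eigenvalues. The bound does not depend on
  the number of terms and serves dominated convergence.\<close>

lemma resolvent_trace_series:
  assumes U: "U \<in> unitary_group N" and r: "cmod r < 1"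
  shows "(\<lambda>m. \<Sum>l<m. r ^ Suc l * (\<Sum>z\<in>#eigenvalues U. z ^ Suc l)) \<longlonglongrightarrow> resolvent_trace N r U"
    and "cmod (\<Sum>l<m. r ^ Suc l * (\<Sum>z\<in>#eigenvalues U. z ^ Suc l)) \<le> real N / (1 - cmod r)"
proof -
  have Uc: "U \<in> carrier_mat N N" using U by (simp add: unitary_group_def)
  have lim: "(\<lambda>m. \<Sum>l<m. r ^ Suc l * (\<Sum>z\<in>#A. z ^ Suc l)) \<longlonglongrightarrow> (\<Sum>z\<in>#A. r * z / (1 - r * z))"
    if "\<And>z. z \<in># A \<Longrightarrow> cmod z = 1" for A
    using that
  proof (induction A)
    case (add a A)
    have "(\<lambda>l. (r * a) * (r * a) ^ l) sums ((r * a) * (1 / (1 - r * a)))"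
      using r add.prems[of a] by (intro sums_mult geometric_sums) (simp add: norm_mult)
    hence "(\<lambda>m. \<Sum>l<m. r ^ Suc l * a ^ Suc l) \<longlonglongrightarrow> r * a / (1 - r * a)"
      by (simp add: sums_def power_mult_distrib mult_ac)
    moreover have "(\<lambda>m. \<Sum>l<m. r ^ Suc l * (\<Sum>z\<in>#A. z ^ Suc l)) \<longlonglongrightarrow> (\<Sum>z\<in>#A. r * z / (1 - r * z))"
      using add by simp
    ultimately have "(\<lambda>m. (\<Sum>l<m. r ^ Suc l * a ^ Suc l) + (\<Sum>l<m. r ^ Suc l * (\<Sum>z\<in>#A. z ^ Suc l)))
      \<longlonglongrightarrow> r * a / (1 - r * a) + (\<Sum>z\<in>#A. r * z / (1 - r * z))" by (rule tendsto_add)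
    thus ?case by (simp add: sum.distrib ring_distribs)
  qed simp
  have "\<And>z. z \<in># eigenvalues U \<Longrightarrow> r * z \<noteq> 1"
    using secular_nonzero[OF U r] by (simp add: secular_nonzero_iff[OF Uc])
  thus "(\<lambda>m. \<Sum>l<m. r ^ Suc l * (\<Sum>z\<in>#eigenvalues U. z ^ Suc l)) \<longlonglongrightarrow> resolvent_trace N r U"
    using lim[of "eigenvalues U"] eigenvalue_unitary_norm[OF U] by (simp add: resolvent_trace_eq_sum[OF Uc])
  have p: "cmod (\<Sum>z\<in>#A. z ^ l) \<le> real (size A)" if "\<And>z. z \<in># A \<Longrightarrow> cmod z = 1" for A l
    using that
  proof (induction A)
    case (add a A)
    have "cmod (a ^ l + (\<Sum>z\<in>#A. z ^ l)) \<le> cmod (a ^ l) + cmod (\<Sum>z\<in>#A. z ^ l)" by (rule norm_triangle_ineq)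
    also have "\<dots> \<le> 1 + real (size A)" using add by (intro add_mono) (auto simp: norm_power)
    finally show ?case by simp
  qed simp
  have "cmod (\<Sum>l<m. r ^ Suc l * (\<Sum>z\<in>#eigenvalues U. z ^ Suc l)) \<le> (\<Sum>l<m. cmod r ^ l * real N)"
  proof (rule sum_norm_le)
    fix l
    have "cmod r ^ Suc l \<le> cmod r ^ l" using r by (intro power_decreasing) auto
    moreover have "cmod (\<Sum>z\<in>#eigenvalues U. z ^ Suc l) \<le> real N"
      using p[of "eigenvalues U" "Suc l"] eigenvalue_unitary_norm[OF U] by (simp add: eigenvalues_size[OF Uc])
    ultimately show "cmod (r ^ Suc l * (\<Sum>z\<in>#eigenvalues U. z ^ Suc l)) \<le> cmod r ^ l * real N"
      unfolding norm_mult norm_power by (intro mult_mono) auto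
  qed
  also have "\<dots> = real N * (\<Sum>l<m. cmod r ^ l)" by (simp add: sum_distrib_left mult.commute)
  also have "\<dots> \<le> real N * (1 / (1 - cmod r))"
  proof (intro mult_left_mono)
    have "(\<Sum>l<m. cmod r ^ l) \<le> (\<Sum>l. cmod r ^ l)"
      using r by (intro sum_le_suminf summable_geometric) auto
    thus "(\<Sum>l<m. cmod r ^ l) \<le> 1 / (1 - cmod r)" using r by (simp add: suminf_geometric)
  qed auto
  finally show "cmod (\<Sum>l<m. r ^ Suc l * (\<Sum>z\<in>#eigenvalues U. z ^ Suc l)) \<le> real N / (1 - cmod r)" by simp
qed

text \<open>\<open>Arg2pi\<close> forgets only the modulus, which is 1 for eigenvalues of a unitary
  matrix.\<close>

lemma Z_fun_eq:
  assumes U: "U \<in> unitary_group N"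
  shows "Z_fun U \<theta> = (\<Prod>z\<in>#eigenvalues U. 1 - exp (- \<i> * of_real \<theta>) * z)"
proof -
  have "1 - exp (\<i> * of_real (Arg2pi z - \<theta>)) = 1 - exp (- \<i> * of_real \<theta>) * z" if "z \<in># eigenvalues U" for z
  proof -
    have "z = exp (\<i> * of_real (Arg2pi z))"
      using Arg2pi[of z] eigenvalue_unitary_norm[OF U that] unfolding is_Arg_def
      by (metis mult_1 of_real_1)
    hence "exp (\<i> * of_real (Arg2pi z - \<theta>)) = exp (- \<i> * of_real \<theta>) * z"
      by (metis (no_types, opaque_lifting) mult_exp_exp add.commute diff_conv_add_uminus minus_mult_commute of_real_add of_real_minus ring_class.ring_distribs(1))
    thus ?thesis by simp
  qed
  thus ?thesis
    unfolding Z_fun_def eigenangles_def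
    by (auto simp: image_mset.compositionality o_def intro!: arg_cong[of _ _ prod_mset] image_mset_cong)
qed

text \<open>The prefactor of V contributes iN/2 to the logarithmic derivative at 0 and the product
  contributes i T(1). As Re T(1) = -N/2, the imaginary parts cancel and V'(0) / V(0) = -Im
  T(1).\<close>

lemma V_fun_V_deriv_0:
  assumes U: "U \<in> unitary_group N"
  shows "cmod (V_fun U 0) * cmod (V_deriv U 0) =
    (cmod (secular N 1 U))\<^sup>2 * \<bar>Im (resolvent_trace N 1 U)\<bar>"
proof -
  have Uc: "U \<in> carrier_mat N N" using U by (simp add: unitary_group_def)
  define s :: real where "s = (\<Sum>t \<in># eigenangles U. t / 2)"
  define c :: complex where "c = \<i> * of_real s"
  define P where "P w = (\<Prod>z\<in>#eigenvalues U. 1 - exp (- \<i> * w) * z)" for w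
  \<comment> \<open>V extended to a complex argument: its complex derivative restricts to the
    derivative along the real line.\<close>
  define W where "W w = exp (\<i> * of_nat N * ((w + of_real pi) / 2) - c) * P w" for w
  have V: "V_fun U \<theta> = W (of_real \<theta>)" for \<theta>
    unfolding V_fun_def W_def P_def Z_fun_eq[OF U] c_def s_def using Uc by simp
  have P0: "P 0 = secular N 1 U" by (simp add: P_def secular_eq_prod[OF Uc])
  have "Re (\<i> * of_nat N * ((0 + of_real pi) / 2) - c) = 0" by (simp add: c_def)
  hence V0: "cmod (V_fun U 0) = cmod (secular N 1 U)"
    unfolding V W_def by (simp add: P0 norm_mult)
  show ?thesis
  proof (cases "secular N 1 U = 0")
    \<comment> \<open>Now V(0) = 0, so neither V'(0) nor the default value of
      \<open>resolvent_trace\<close> matters.\<close>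
    case True
    thus ?thesis using V0 by simp
  next
    case False
    let ?T = "resolvent_trace N 1 U"
    have nz: "z \<noteq> 1" if "z \<in># eigenvalues U" for z
      using False that by (auto simp: secular_nonzero_iff[OF Uc])
    have "((\<lambda>w. \<Prod>z\<in>#A. 1 - exp (- \<i> * w) * z) has_field_derivative
        (\<Prod>z\<in>#A. 1 - z) * (\<i> * (\<Sum>z\<in>#A. z / (1 - z)))) (at 0)" if "\<And>z. z \<in># A \<Longrightarrow> z \<noteq> 1" for A
      using that
    proof (induction A)
      case (add a A)
      let ?p = "\<Prod>z\<in>#A. 1 - z" and ?s = "\<Sum>z\<in>#A. z / (1 - z)"
      have "((\<lambda>w. (1 - exp (- \<i> * w) * a) * (\<Prod>z\<in>#A. 1 - exp (- \<i> * w) * z)) has_field_derivative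
          (\<i> * a) * ?p + (?p * (\<i> * ?s)) * (1 - a)) (at 0)"
        by (rule DERIV_cong[OF DERIV_mult[OF _ add.IH]])
           (use add.prems in \<open>auto intro!: derivative_eq_intros\<close>)
      moreover have "(\<i> * a) * ?p + (?p * (\<i> * ?s)) * (1 - a) = (1 - a) * ?p * (\<i> * (a / (1 - a) + ?s))"
      proof -
        have "\<i> * a * p + (p * (\<i> * s)) * b = b * p * (\<i> * (a / b + s))" if "b \<noteq> 0" for p s b :: complex
          using that by (simp add: field_simps)
        moreover have "1 - a \<noteq> 0" using add.prems[of a] by simp
        ultimately show ?thesis by blast
      qed
      ultimately show ?case by simp
    qed simp
    from this[OF nz] have dP: "(P has_field_derivative secular N 1 U * (\<i> * ?T)) (at 0)"
      using nz by (simp add: P_def[abs_def] secular_eq_prod[OF Uc] resolvent_trace_eq_sum[OF Uc])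
    have "(W has_field_derivative W 0 * (\<i> * of_nat N / 2 + \<i> * ?T)) (at 0)"
      unfolding W_def
      by (rule derivative_eq_intros dP refl | simp add: P0)+ (simp add: algebra_simps)
    moreover have "\<i> * of_nat N / 2 + \<i> * ?T = - of_real (Im ?T)"
      using Re_resolvent_trace_ge(2)[OF U _ False] by (simp add: complex_eq_iff)
    ultimately have "(W has_field_derivative W 0 * (- of_real (Im ?T))) (at (of_real 0))" by simp
    hence "((\<lambda>\<theta>. W (of_real \<theta>)) has_vector_derivative W 0 * (- of_real (Im ?T))) (at 0)"
      by (rule has_vector_derivative_real_field)
    hence "V_deriv U 0 = V_fun U 0 * (- of_real (Im ?T))"
      unfolding V_deriv_def V[abs_def] by (simp add: vector_derivative_at V)
    thus ?thesis by (simp add: norm_mult V0 power2_eq_square)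
  qed
qed

section \<open>The scalar integrals and the limit\<close>

text \<open>For a nonnegative integrand the limits of an antiderivative at both ends already yield
  integrability. Only a limit is asked at 0, where the antiderivatives below divide by x.\<close>

lemma FTC_nonneg_greaterThan:
  fixes f F :: "real \<Rightarrow> real"
  assumes F: "\<And>x. x > 0 \<Longrightarrow> DERIV F x :> f x"
    and f: "\<And>x. x > 0 \<Longrightarrow> isCont f x" "\<And>x. x > 0 \<Longrightarrow> 0 \<le> f x"
    and lim: "(F \<longlongrightarrow> A) (at_right 0)" "(F \<longlongrightarrow> B) at_top"
  shows "has_bochner_integral lborel (\<lambda>x. indicator {0<..} x * f x) (B - A)"
proof -
  have "set_integrable lborel (einterval 0 \<infinity>) f" "(LBINT x=0..\<infinity>. f x) = B - A"
    by (rule interval_integral_FTC_nonneg[where F = F];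
        use F f lim in \<open>simp add: ereal_tendsto_simps zero_ereal_def\<close>)+
  moreover have "einterval 0 \<infinity> = {0::real<..}" by (auto simp: einterval_def)
  ultimately show ?thesis
    by (simp add: has_bochner_integral_iff set_integrable_def interval_lebesgue_integral_def
        set_lebesgue_integral_def)
qed

text \<open>Integration by parts gives the antiderivative y Si(y x) - (1 - cos(y x)) / x for y > 0,
  and Si tends to pi/2. Negative y follow because the cosine is even.\<close>

lemma has_bochner_integral_one_minus_cos:
  "has_bochner_integral lborel (\<lambda>x. indicator {0<..} x * ((1 - cos (y * x)) / x\<^sup>2)) (pi / 2 * \<bar>y\<bar>)"
proof -
  have pos: "has_bochner_integral lborel (\<lambda>x. indicator {0<..} x * ((1 - cos (y * x)) / x\<^sup>2)) (pi / 2 * y)"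
    if "y > 0" for y
  proof -
    have "has_bochner_integral lborel (\<lambda>x. indicator {0<..} x * ((1 - cos (y * x)) / x\<^sup>2)) (y * (pi / 2) - 0 - (y * Si (y * 0) - 0))"
    proof (rule FTC_nonneg_greaterThan[where F = "\<lambda>x. y * Si (y * x) - (1 - cos (y * x)) / x"])
      fix x :: real assume x: "x > 0"
      show "DERIV (\<lambda>x. y * Si (y * x) - (1 - cos (y * x)) / x) x :> (1 - cos (y * x)) / x\<^sup>2"
        using x that
        by (auto intro!: derivative_eq_intros DERIV_chain'[OF _ DERIV_Si] simp: field_simps power2_eq_square)
      show "isCont (\<lambda>x. (1 - cos (y * x)) / x\<^sup>2) x" using x by (intro continuous_intros) auto
      show "(1 - cos (y * x)) / x\<^sup>2 \<ge> 0" by simp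
    next
      have "((\<lambda>x. (1 - cos (y * x)) / x) \<longlongrightarrow> 0) (at_right 0)" using that by real_asymp
      thus "((\<lambda>x. y * Si (y * x) - (1 - cos (y * x)) / x) \<longlongrightarrow> y * Si (y * 0) - 0) (at_right 0)"
        by (intro tendsto_intros isCont_tendsto_compose[OF isCont_Si]) auto
      have "filterlim (\<lambda>x. y * x) at_top at_top" using that by real_asymp
      moreover have "((\<lambda>x. (1 - cos (y * x)) / x) \<longlongrightarrow> 0) at_top" using that by real_asymp
      ultimately show "((\<lambda>x. y * Si (y * x) - (1 - cos (y * x)) / x) \<longlongrightarrow> y * (pi / 2) - 0) at_top"
        by (intro tendsto_intros filterlim_compose[OF Si_at_top])
    qed
    moreover have "Si 0 = 0" by (simp add: Si_alt_def zero_ereal_def)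
    ultimately show ?thesis by (simp add: mult.commute)
  qed
  show ?thesis
  proof (cases "y = 0")
    case False
    have "cos (\<bar>y\<bar> * x) = cos (y * x)" for x by (cases "y \<ge> 0") auto
    thus ?thesis using pos[of "\<bar>y\<bar>"] False by simp
  qed (simp add: has_bochner_integral_zero)
qed

text \<open>The integrand is the derivative of -(1 - exp(-x)) / x, which rises from -1 to 0. It is
  what the terms j = 0 and j = 1 contribute in \<open>has_bochner_integral_laguerre\<close>.\<close>

lemma has_bochner_integral_exp_remainder:
  "has_bochner_integral lborel (\<lambda>x. indicator {0<..} x * ((1 - exp (- x) * (1 + x)) / x\<^sup>2)) (1 :: real)"
proof -
  have "has_bochner_integral lborel (\<lambda>x. indicator {0<..} x * ((1 - exp (- x) * (1 + x)) / x\<^sup>2)) (0 - (-1 :: real))"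
  proof (rule FTC_nonneg_greaterThan[where F = "\<lambda>x. - (1 - exp (- x)) / x"])
    fix x :: real assume x: "x > 0"
    show "DERIV (\<lambda>x. - (1 - exp (- x)) / x) x :> (1 - exp (- x) * (1 + x)) / x\<^sup>2"
      using x by (auto intro!: derivative_eq_intros simp: field_simps power2_eq_square)
    show "isCont (\<lambda>x. (1 - exp (- x) * (1 + x)) / x\<^sup>2) x" using x by (intro continuous_intros) auto
    have "exp (- x) * (1 + x) \<le> exp (- x) * exp x" by (intro mult_left_mono exp_ge_add_one_self) auto
    thus "(1 - exp (- x) * (1 + x)) / x\<^sup>2 \<ge> 0" by (simp add: exp_minus)
  next
    show "((\<lambda>x::real. - (1 - exp (- x)) / x) \<longlongrightarrow> -1) (at_right 0)" by real_asymp
    show "((\<lambda>x::real. - (1 - exp (- x)) / x) \<longlongrightarrow> 0) at_top" by real_asymp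
  qed
  thus ?thesis by simp
qed

lemma has_bochner_integral_power_exp:
  "has_bochner_integral lborel (\<lambda>x. indicator {0<..} x * (x ^ k * exp (- x))) (fact k :: real)"
proof -
  have "has_bochner_integral lborel (\<lambda>x. indicator {0..} x *\<^sub>R (x ^ k * exp (- x))) (fact k :: real)"
    using nn_intergal_power_times_exp_Ici[of k]
    by (intro has_bochner_integral_nn_integral)
       (auto simp: nn_integral_set_ennreal[symmetric] indicator_def mult.commute intro!: nn_integral_cong arg_cong[of _ _ ennreal] elim!: trans[rotated])
  moreover have "AE x in lborel. indicator {0..} x *\<^sub>R (x ^ k * exp (- x)) = indicator {0<..} x * (x ^ k * exp (- x :: real))"
    using AE_lborel_singleton[of "0::real"] by eventually_elim (auto simp: indicator_def)
  ultimately show ?thesis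
    by (subst has_bochner_integral_cong_AE[symmetric]) auto
qed

text \<open>The $j = 0$ and $j = 1$ terms both have coefficient $N + 1$; they cancel the double pole at $0$.\<close>

lemma has_bochner_integral_laguerre:
  fixes N :: nat
  defines "g \<equiv> \<lambda>x::real. exp (- x) * (\<Sum>j\<le>N. real (Suc N choose Suc j) * (2 * x / real N) ^ j / fact j)"
  assumes N: "N \<ge> 1"
  shows "has_bochner_integral lborel (\<lambda>x. indicator {0<..} x * ((real N + 1 - g x) / x\<^sup>2))
    (real N + 1 - (\<Sum>j\<in>{2..N}. real (Suc N choose Suc j) * (2 / real N) ^ j / (real j * (real j - 1))))"
proof -
  \<comment> \<open>After division by x^2 the j-th term integrates to (j - 2)! times its
    coefficient, and (j - 2)! / j! = 1 / (j (j - 1)).\<close>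
  let ?c = "\<lambda>j. real (Suc N choose Suc j) * (2 / real N) ^ j / fact j"
  have "has_bochner_integral lborel
    (\<lambda>x. (real N + 1) * (indicator {0<..} x * ((1 - exp (- x) * (1 + x)) / x\<^sup>2)) -
      (\<Sum>j\<in>{2..N}. ?c j * (indicator {0<..} x * (x ^ (j - 2) * exp (- x)))))
    ((real N + 1) * 1 - (\<Sum>j\<in>{2..N}. ?c j * fact (j - 2)))"
    by (intro has_bochner_integral_diff has_bochner_integral_sum 
        has_bochner_integral_exp_remainder has_bochner_integral_power_exp has_bochner_integral_mult_right)
  also have "(\<lambda>x. (real N + 1) * (indicator {0<..} x * ((1 - exp (- x) * (1 + x)) / x\<^sup>2)) -
      (\<Sum>j\<in>{2..N}. ?c j * (indicator {0<..} x * (x ^ (j - 2) * exp (- x))))) =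
    (\<lambda>x. indicator {0<..} x * ((real N + 1 - g x) / x\<^sup>2))"
  proof
    fix x :: real
    show "(real N + 1) * (indicator {0<..} x * ((1 - exp (- x) * (1 + x)) / x\<^sup>2)) -
      (\<Sum>j\<in>{2..N}. ?c j * (indicator {0<..} x * (x ^ (j - 2) * exp (- x)))) =
      indicator {0<..} x * ((real N + 1 - g x) / x\<^sup>2)"
    proof (cases "x > 0")
      case True
      let ?h = "\<lambda>j. real (Suc N choose Suc j) * (2 * x / real N) ^ j / fact j"
      have "{..N} = insert 0 (insert 1 {2..N})" using N by auto
      hence "(\<Sum>j\<in>{..N}. ?h j) = ?h 0 + (?h 1 + (\<Sum>j\<in>{2..N}. ?h j))" by simp
      moreover have "?h 0 = real N + 1" by simp
      \<comment> \<open>Because binomial(N + 1, 2) * 2 / N = N + 1.\<close>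
      moreover have "?h 1 = (real N + 1) * x"
      proof -
        have "real (Suc N choose 2) = (real N + 1) * real N / 2"
          by (simp add: choose_two real_of_nat_div algebra_simps)
        moreover have "c * (2 * x) / n = (n + 1) * x" if "c = (n + 1) * n / 2" "n \<noteq> 0" for c n :: real
          using that(2) unfolding that(1) by simp
        ultimately have "real (Suc N choose 2) * (2 * x) / real N = (real N + 1) * x" using N by simp
        thus ?thesis by (simp add: numeral_2_eq_2[symmetric] del: binomial_Suc_Suc)
      qed
      moreover have "?h j = ?c j * x ^ j" for j by (simp add: power_mult_distrib power_divide)
      ultimately have "(\<Sum>j\<in>{..N}. ?h j) = (real N + 1) + ((real N + 1) * x + (\<Sum>j\<in>{2..N}. ?c j * x ^ j))"
        by (simp only:)
      also have "\<dots> = (real N + 1) * (1 + x) + (\<Sum>j\<in>{2..N}. ?c j * x ^ j)"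
        by (simp only: ring_distribs mult_1_right add_ac)
      finally have "g x = exp (- x) * ((real N + 1) * (1 + x) + (\<Sum>j\<in>{2..N}. ?c j * x ^ j))"
        by (simp only: g_def)
      have xj: "x ^ j = x ^ (j - 2) * x\<^sup>2" if "j \<in> {2..N}" for j
      proof -
        have "j = (j - 2) + 2" using that by (metis atLeastAtMost_iff le_add_diff_inverse2)
        thus ?thesis by (metis power_add)
      qed
      have "(\<Sum>j\<in>{2..N}. ?c j * x ^ j) = x\<^sup>2 * (\<Sum>j\<in>{2..N}. ?c j * x ^ (j - 2))"
        unfolding sum_distrib_left
      proof (rule sum.cong[OF refl])
        fix j assume "j \<in> {2..N}"
        show "?c j * x ^ j = x\<^sup>2 * (?c j * x ^ (j - 2))"
          by (subst xj[OF \<open>j \<in> {2..N}\<close>]) (simp only: mult_ac)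
      qed
      hence g: "g x = (real N + 1) * (exp (- x) * (1 + x)) + x\<^sup>2 * (\<Sum>j\<in>{2..N}. ?c j * (x ^ (j - 2) * exp (- x)))"
        unfolding \<open>g x = exp (- x) * ((real N + 1) * (1 + x) + (\<Sum>j\<in>{2..N}. ?c j * x ^ j))\<close>
        by (simp only: ring_distribs sum_distrib_left mult_ac)
      have "(a * (1 - e) / d - s) = (a - (a * e + d * s)) / d" if "d \<noteq> 0" for a e d s :: real
        using that by (simp add: field_simps)
      from this[of "x\<^sup>2"] True show ?thesis by (simp add: g)
    qed simp
  qed
  also have "(real N + 1) * 1 - (\<Sum>j\<in>{2..N}. ?c j * fact (j - 2)) =
      real N + 1 - (\<Sum>j\<in>{2..N}. real (Suc N choose Suc j) * (2 / real N) ^ j / (real j * (real j - 1)))"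
  proof -
    have "?c j * fact (j - 2) = real (Suc N choose Suc j) * (2 / real N) ^ j / (real j * (real j - 1))"
      if "j \<in> {2..N}" for j
    proof -
      define i where "i = j - 2"
      have "2 \<le> j" using that by simp
      hence j: "j = Suc (Suc i)" unfolding i_def by arith
      have "c / fact j * fact (j - 2) = c / (real j * (real j - 1))" for c
        unfolding j by (simp add: divide_simps)
      thus ?thesis .
    qed
    thus ?thesis by simp
  qed
  finally show ?thesis .
qed

section \<open>The limit of the finite sums\<close>

lemma sums_limit_series:
  "(\<lambda>j. 2 ^ (j + 2) / (fact (j + 3) * (real (j + 2) * (real (j + 2) - 1)))) sums (1 - (exp 1 ^ 2 - 5) / 4)"
proof -
  \<comment> \<open>the terms are $B_j - B_{j+1}$ up to a multiple of the terms of the exponential series\<close>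
  define B where "B j = 2 ^ (j + 1) / (real (j + 1) * fact (j + 2))" for j
  have "(\<lambda>j. (2::real) ^ j / fact j) sums exp 2"
    using exp_converges[of "2::real"] by (simp add: field_simps)
  hence "(\<lambda>j. (2::real) ^ (j + 3) / fact (j + 3)) sums (exp 2 - (\<Sum>j<3. 2 ^ j / fact j))"
    by (rule sums_split_initial_segment)
  \<comment> \<open>The 5 is 1 + 2 + 2, the first three terms of the series for exp 2.\<close>
  hence e: "(\<lambda>j. (1 / 4) * ((2::real) ^ (j + 3) / fact (j + 3))) sums ((1 / 4) * (exp 2 - 5))"
    by (intro sums_mult) (simp add: eval_nat_numeral)
  have "(\<lambda>j. B j - B (Suc j)) sums (B 0 - 0)"
  proof (rule telescope_sums')
    have "summable (\<lambda>j. (2::real) ^ j / fact j)"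
      using \<open>(\<lambda>j. (2::real) ^ j / fact j) sums exp 2\<close> by (rule sums_summable)
    hence "(\<lambda>j. (2::real) ^ j / fact j) \<longlonglongrightarrow> 0" by (rule summable_LIMSEQ_zero)
    from LIMSEQ_ignore_initial_segment[OF this, of 2] 
    have lim: "(\<lambda>j. (2::real) ^ (j + 2) / fact (j + 2)) \<longlonglongrightarrow> 0" .
    show "B \<longlonglongrightarrow> 0"
    proof (rule Lim_null_comparison[OF _ lim], rule always_eventually, rule allI)
      fix j
      have "2 ^ (j + 1) * 1 \<le> 2 ^ (j + 2) * real (j + 1)" by (intro mult_mono) auto
      hence "2 ^ (j + 1) / real (j + 1) \<le> 2 ^ (j + 2)" by (simp add: divide_le_eq)
      hence "2 ^ (j + 1) / real (j + 1) / fact (j + 2) \<le> 2 ^ (j + 2) / fact (j + 2)"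
        by (intro divide_right_mono) auto
      thus "norm (B j) \<le> 2 ^ (j + 2) / fact (j + 2)" by (simp add: B_def)
    qed
  qed
  from this e have "(\<lambda>j. (B j - B (Suc j)) - (1 / 4) * ((2::real) ^ (j + 3) / fact (j + 3))) sums
      ((B 0 - 0) - (1 / 4) * (exp 2 - 5))" by (rule sums_diff)
  also have "(\<lambda>j. (B j - B (Suc j)) - (1 / 4) * ((2::real) ^ (j + 3) / fact (j + 3))) =
      (\<lambda>j. 2 ^ (j + 2) / (fact (j + 3) * (real (j + 2) * (real (j + 2) - 1))))"
  proof
    fix j
    have f: "fact (j + 3) = (real (j + 3)) * fact (j + 2)" by (simp add: eval_nat_numeral algebra_simps)
    have p: "fact (j + 2) > (0::real)" by simp
    define F :: real where "F = fact (j + 2)"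
    define t :: real where "t = 2 ^ j"
    define x where "x = real j"
    \<comment> \<open>Clearing denominators leaves (x + 2)(x + 3) - 2(x + 1) - (x + 1)(x + 2) =
      2.\<close>
    have "2 * t / ((x + 1) * F) - 4 * t / ((x + 2) * ((x + 3) * F)) - (1 / 4) * (8 * t / ((x + 3) * F)) =
        4 * t / ((x + 3) * F * ((x + 2) * (x + 1)))"
    proof -
      have "x + 1 \<noteq> 0" "x + 2 \<noteq> 0" "x + 3 \<noteq> 0" "F \<noteq> 0" by (auto simp: x_def F_def)
      thus ?thesis by (simp add: divide_simps) (simp add: algebra_simps)
    qed
    moreover have "B j = 2 * t / ((x + 1) * F)" by (simp add: B_def t_def x_def F_def)
    moreover have "B (Suc j) = 4 * t / ((x + 2) * ((x + 3) * F))"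
      using f by (simp add: B_def t_def x_def F_def eval_nat_numeral algebra_simps)
    moreover have "(2::real) ^ (j + 3) / fact (j + 3) = 8 * t / ((x + 3) * F)"
      unfolding f by (simp add: t_def x_def F_def power_add)
    moreover have "2 ^ (j + 2) / (fact (j + 3) * (real (j + 2) * (real (j + 2) - 1))) =
        4 * t / ((x + 3) * F * ((x + 2) * (x + 1)))"
      unfolding f by (simp add: t_def x_def F_def power_add add_ac)
    ultimately show "(B j - B (Suc j)) - (1 / 4) * ((2::real) ^ (j + 3) / fact (j + 3)) =
      2 ^ (j + 2) / (fact (j + 3) * (real (j + 2) * (real (j + 2) - 1)))" by simp
  qed
  also have "(B 0 - 0) - (1 / 4) * (exp 2 - 5) = 1 - (exp 1 ^ 2 - 5) / (4 :: real)"
    by (simp add: B_def exp_of_nat_mult[of 2 "1::real", simplified, symmetric])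
  finally show ?thesis .
qed

text \<open>For n >= 1 each of the m factors of the falling factorial is at most n + 1 <= 2 n. The
  bound is free of n and supplies the summable majorant.\<close>

lemma choose_over_power_le:
  assumes "n \<ge> 1"
  shows "real (Suc n choose m) / real n ^ m \<le> 2 ^ m / fact m"
proof -
  have "real ((Suc n choose m) * fact m) \<le> real (Suc n ^ m)"
    by (intro of_nat_mono binomial_fact_pow)
  also have "\<dots> \<le> (2 * real n) ^ m"
    unfolding of_nat_power using assms by (intro power_mono) auto
  finally show ?thesis using assms by (simp add: field_simps)
qed

lemma choose_over_power_tendsto:
  "(\<lambda>n. real (Suc n choose m) / real n ^ m) \<longlonglongrightarrow> 1 / fact m"
proof -
  have "(\<lambda>n. (\<Prod>i=0..<m. (real (Suc n) - real i) / real n) / fact m) \<longlonglongrightarrow> (\<Prod>i=0..<m. 1) / fact m"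
  proof (intro tendsto_divide tendsto_prod tendsto_const)
    fix i show "(\<lambda>n. (real (Suc n) - real i) / real n) \<longlonglongrightarrow> 1" by real_asymp
  qed auto
  moreover have "(\<Prod>i=0..<m. (real (Suc n) - real i) / real n) / fact m =
      real (Suc n choose m) / real n ^ m" for n
    unfolding binomial_gbinomial gbinomial_prod_rev prod_dividef by simp
  ultimately show ?thesis by simp
qed

text \<open>Tannery's theorem on the sum, whose limit is that of \<open>sums_limit_series\<close>.
  The first term contributes 1, so 1 / pi * (1 - (1 - (e^2 - 5) / 4)) remains.\<close>

lemma laguerre_sum_tendsto:
  "(\<lambda>n. 1 / (pi * real n) * (real n + 1 -
      (\<Sum>j\<in>{2..n}. real (Suc n choose Suc j) * (2 / real n) ^ j / (real j * (real j - 1)))))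
    \<longlonglongrightarrow> (exp 1 ^ 2 - 5) / (4 * pi)"
proof -
  \<comment> \<open>Here \<open>i = j - 2\<close>, and terms beyond the range of summation are 0.
    The prefactor 1 / n is absorbed, so that the power of n matches the lower index i + 3 of the
    binomial.\<close>
  define a where "a i n = (if i + 2 \<le> n then real (Suc n choose (i + 3)) / real n ^ (i + 3) *
    (2 ^ (i + 2) / (real (i + 2) * (real (i + 2) - 1))) else 0)" for i n
  define b where "b i = 2 ^ (i + 2) / (fact (i + 3) * (real (i + 2) * (real (i + 2) - 1)))" for i :: nat
  \<comment> \<open>The bound 2^m / m! for m = i + 3, times 2^(i + 3) for the remaining
    factor.\<close>
  define M :: "nat \<Rightarrow> real" where "M i = 4 ^ (i + 3) / fact (i + 3)" for i
  have "(\<lambda>i. (4::real) ^ i / fact i) sums exp 4"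
    using exp_converges[of "4::real"] by (simp add: field_simps)
  hence "summable (\<lambda>i. (4::real) ^ i / fact i)" by (rule sums_summable)
  hence summ: "summable M" unfolding M_def by (rule summable_ignore_initial_segment)
  have bound: "norm (a i n) \<le> M i" for i n
  proof (cases "i + 2 \<le> n")
    case True
    have "real (Suc n choose (i + 3)) / real n ^ (i + 3) *
        (2 ^ (i + 2) / (real (i + 2) * (real (i + 2) - 1))) \<le> (2 ^ (i + 3) / fact (i + 3)) * 2 ^ (i + 3)"
    proof (intro mult_mono choose_over_power_le)
      have "real (i + 2) * (real (i + 2) - 1) \<ge> 1 * 1" by (intro mult_mono) auto
      hence "2 ^ (i + 2) / (real (i + 2) * (real (i + 2) - 1)) \<le> 2 ^ (i + 2) / 1"
        by (intro divide_left_mono) auto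
      also have "2 ^ (i + 2) / 1 \<le> (2 :: real) ^ (i + 3)" by (simp add: power_add)
      finally show "2 ^ (i + 2) / (real (i + 2) * (real (i + 2) - 1)) \<le> 2 ^ (i + 3)" .
    qed (use True in auto)
    also have "\<dots> = M i" by (simp add: M_def power_mult_distrib[symmetric])
    finally show ?thesis using True by (simp add: a_def)
  qed (simp add: a_def M_def)
  have lim: "a i \<longlonglongrightarrow> b i" for i
  proof -
    have "(\<lambda>n. real (Suc n choose (i + 3)) / real n ^ (i + 3) *
        (2 ^ (i + 2) / (real (i + 2) * (real (i + 2) - 1)))) \<longlonglongrightarrow>
      1 / fact (i + 3) * (2 ^ (i + 2) / (real (i + 2) * (real (i + 2) - 1)))"
      by (intro tendsto_mult choose_over_power_tendsto tendsto_const)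
    moreover have "eventually (\<lambda>n. real (Suc n choose (i + 3)) / real n ^ (i + 3) *
        (2 ^ (i + 2) / (real (i + 2) * (real (i + 2) - 1))) = a i n) sequentially"
      using eventually_ge_at_top[of "i + 2"] by eventually_elim (simp add: a_def)
    ultimately show ?thesis unfolding b_def by (rule Lim_transform_eventually[THEN tendsto_eq_rhs]) simp
  qed
  have "(\<lambda>n. \<Sum>i. a i n) \<longlonglongrightarrow> (\<Sum>i. b i)"
    by (intro tannerys_theorem[where M = M, THEN conjunct2, THEN conjunct2] lim summ always_eventually)
       (use bound in auto)
  also have "(\<Sum>i. b i) = 1 - (exp 1 ^ 2 - 5) / 4"
    using sums_limit_series unfolding b_def by (rule sums_unique[symmetric])
  finally have "(\<lambda>n. (real n + 1) / real n - (\<Sum>i. a i n)) \<longlonglongrightarrow> 1 - (1 - (exp 1 ^ 2 - 5) / 4)"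
    by (intro tendsto_diff) real_asymp
  hence "(\<lambda>n. 1 / pi * ((real n + 1) / real n - (\<Sum>i. a i n))) \<longlonglongrightarrow> 1 / pi * (1 - (1 - (exp 1 ^ 2 - 5) / 4))"
    by (intro tendsto_mult tendsto_const)
  moreover have "eventually (\<lambda>n. 1 / pi * ((real n + 1) / real n - (\<Sum>i. a i n)) =
      1 / (pi * real n) * (real n + 1 -
      (\<Sum>j\<in>{2..n}. real (Suc n choose Suc j) * (2 / real n) ^ j / (real j * (real j - 1))))) sequentially"
    using eventually_ge_at_top[of 2]
  proof eventually_elim
    case (elim n)
    have "(\<Sum>i. a i n) = (\<Sum>i\<in>{..n - 2}. a i n)"
      using elim by (intro suminf_finite) (auto simp: a_def)
    also have "\<dots> = (\<Sum>j\<in>{2..n}. a (j - 2) n)"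
      using elim by (intro sum.reindex_bij_witness[of _ "\<lambda>j. j - 2" "\<lambda>i. i + 2"]) auto
    also have "\<dots> = (\<Sum>j\<in>{2..n}. real (Suc n choose Suc j) * (2 / real n) ^ j / (real j * (real j - 1)) / real n)"
    proof (rule sum.cong[OF refl])
      fix j assume "j \<in> {2..n}"
      then obtain i where i: "j = i + 2" by (metis atLeastAtMost_iff le_add_diff_inverse2)
      show "a (j - 2) n = real (Suc n choose Suc j) * (2 / real n) ^ j / (real j * (real j - 1)) / real n"
        using \<open>j \<in> {2..n}\<close> unfolding i
        by (simp add: a_def power_divide mult_ac eval_nat_numeral)
    qed
    finally have "(\<Sum>i. a i n) = (\<Sum>j\<in>{2..n}. real (Suc n choose Suc j) * (2 / real n) ^ j / (real j * (real j - 1))) / real n"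
      by (simp add: sum_divide_distrib)
    thus ?case using elim by (simp add: field_simps)
  qed
  ultimately show ?thesis
    by (rule Lim_transform_eventually[THEN tendsto_eq_rhs]) (simp add: field_simps)
qed

section \<open>Integrals against the secular polynomial\<close>

text \<open>In generating functions: if $A_0 = 1$ and $A_{j+1}(t) / (1 - rt) = -rt A_j(t) / (1 - rt)^2$, then
  $A_j(t) / (1 - rt) = (-rt)^j / (1 - rt)^{j+1}$.\<close>

lemma geometric_convolution_choose:
  fixes a :: "nat \<Rightarrow> nat \<Rightarrow> 'a :: comm_ring_1"
  assumes a0: "\<And>k. k \<le> n \<Longrightarrow> a 0 k = (if k = 0 then 1 else 0)"
    and step: "\<And>j k. k \<le> n \<Longrightarrow>
      (\<Sum>i\<le>k. r ^ i * a (Suc j) (k - i)) = - (\<Sum>i\<le>k. of_nat i * r ^ i * a j (k - i))"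
    and k: "k \<le> n"
  shows "(\<Sum>i\<le>k. r ^ i * a j (k - i)) = (-1) ^ j * r ^ k * of_nat (k choose j)"
  using k
proof (induction j arbitrary: k)
  case 0
  have "(\<Sum>i\<le>k. r ^ i * a 0 (k - i)) = (\<Sum>i\<le>k. if i = k then r ^ i else 0)"
    using 0 by (intro sum.cong) (auto simp: a0)
  thus ?case by simp
next
  case (Suc j)
  define c where "c k = - (\<Sum>i\<le>k. of_nat i * r ^ i * a j (k - i))" for k
  have c0: "c 0 = 0" by (simp add: c_def)
  \<comment> \<open>Shifting the index turns the weight i into i + 1. Together with the formula for
    \<open>j\<close>, this recurrence is Pascal's rule.\<close>
  have cS: "c (Suc k) = r * c k - r * (\<Sum>i\<le>k. r ^ i * a j (k - i))" for k
    unfolding c_def by (subst sum.atMost_Suc_shift)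
      (simp add: algebra_simps sum.distrib sum_distrib_left)
  have "c k = (-1) ^ Suc j * r ^ k * of_nat (k choose Suc j)" if "k \<le> n" for k
    using that
  proof (induction k)
    case (Suc k)
    thus ?case using Suc.IH \<open>\<And>k. k \<le> n \<Longrightarrow> (\<Sum>i\<le>k. r ^ i * a j (k - i)) = (-1) ^ j * r ^ k * of_nat (k choose j)\<close>[of k]
      by (simp add: cS algebra_simps)
  qed (simp add: c0)
  thus ?case using Suc.prems step[of k j] by (simp add: c_def)
qed

context haar
begin

lemma bounded_measurable_secular: "bounded_measurable (secular N r)"
proof -
  have "bounded_measurable (\<lambda>U. secular N r U)"
    unfolding secular_def by (intro bounded_measurable_intros)
  thus ?thesis by simp
qed

lemma measurable_resolvent_trace: "resolvent_trace N r \<in> borel_measurable M"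
proof -
  have "(\<lambda>U. resolvent_trace N r U) \<in> borel_measurable M"
    unfolding resolvent_trace_def
    by (intro borel_measurable_divide borel_measurable_uminus borel_measurable_sum borel_measurable_times
        borel_measurable_const bounded_measurableD[OF bounded_measurable_secular]
        bounded_measurableD[OF bounded_measurable_esym])
  thus ?thesis by simp
qed

lemma norm_resolvent_trace_le:
  assumes "U \<in> unitary_group N" "cmod r < 1"
  shows "cmod (resolvent_trace N r U) \<le> real N / (1 - cmod r)"
  using resolvent_trace_series[OF assms]
  by (intro LIMSEQ_le_const2[OF tendsto_norm]) auto

lemma bounded_measurable_resolvent_trace:
  "cmod r < 1 \<Longrightarrow> bounded_measurable (resolvent_trace N r)"
  by (rule bounded_measurableI[OF measurable_resolvent_trace norm_resolvent_trace_le])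

lemma integral_tendsto_bounded:
  fixes s :: "nat \<Rightarrow> complex mat \<Rightarrow> complex"
  assumes meas: "\<And>m. s m \<in> borel_measurable M" "f \<in> borel_measurable M"
    and lim: "\<And>U. U \<in> unitary_group N \<Longrightarrow> (\<lambda>m. s m U) \<longlonglongrightarrow> f U"
    and bound: "\<And>m U. U \<in> unitary_group N \<Longrightarrow> cmod (s m U) \<le> B"
  shows "(\<lambda>m. \<integral>U. s m U \<partial>M) \<longlonglongrightarrow> (\<integral>U. f U \<partial>M)"
  by (rule integral_dominated_convergence[where w = "\<lambda>_. B"])
     (use assms in \<open>auto simp: space_eq\<close>)

text \<open>Powers of the partial sums of T(r) are polynomials in the entries and converge
  boundedly, so \<open>integral_esym_esym\<close> passes to the limit.\<close>

lemma integral_resolvent_trace_esym: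
  assumes r: "cmod r < 1" and k: "k \<le> N"
  shows "(\<integral>U. resolvent_trace N r U ^ i * esym N j U * cnj (esym N k U) \<partial>M) =
    (if j \<le> k then (\<integral>U. resolvent_trace N r U ^ i * cnj (esym N (k - j) U) \<partial>M) else 0)"
proof -
  obtain p where p: "\<And>l. entry_poly N (p l)"
    "\<And>l U. U \<in> unitary_group N \<Longrightarrow> (\<Sum>z\<in>#eigenvalues U. z ^ Suc l) = p l U"
    using entry_poly_power_sum by metis
  define F where "F m U = (\<Sum>l<m. r ^ Suc l * p l U)" for m U
  have F: "entry_poly N (F m)" for m
    unfolding F_def[abs_def] by (intro entry_poly_sum entry_poly_mult entry_poly_const p)
  have FU: "F m U = (\<Sum>l<m. r ^ Suc l * (\<Sum>z\<in>#eigenvalues U. z ^ Suc l))"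
    if "U \<in> unitary_group N" for m U
    by (simp only: F_def p(2)[OF that])
  have lim: "(\<lambda>m. F m U) \<longlonglongrightarrow> resolvent_trace N r U" and bound: "cmod (F m U) \<le> real N / (1 - cmod r)"
    if "U \<in> unitary_group N" for m U
    using resolvent_trace_series[OF that r] by (simp_all only: FU[OF that])
  have conv: "(\<lambda>m. \<integral>U. F m U ^ i * g U \<partial>M) \<longlonglongrightarrow> (\<integral>U. resolvent_trace N r U ^ i * g U \<partial>M)"
    if g: "bounded_measurable g" for g
  proof -
    obtain B where B: "\<And>U. U \<in> unitary_group N \<Longrightarrow> cmod (g U) \<le> B"
      using g by (auto simp: bounded_measurable_def)
    show ?thesis
    proof (rule integral_tendsto_bounded)
      show "(\<lambda>U. F m U ^ i * g U) \<in> borel_measurable M" for m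
        by (intro bounded_measurableD bounded_measurable_intros bounded_measurable_entry_poly F g)
      show "(\<lambda>U. resolvent_trace N r U ^ i * g U) \<in> borel_measurable M"
        by (intro bounded_measurableD bounded_measurable_intros bounded_measurable_resolvent_trace r g)
      fix U assume U: "U \<in> unitary_group N"
      show "(\<lambda>m. F m U ^ i * g U) \<longlonglongrightarrow> resolvent_trace N r U ^ i * g U"
        by (intro tendsto_intros lim U)
      show "cmod (F m U ^ i * g U) \<le> (real N / (1 - cmod r)) ^ i * B" for m
        using bound[OF U, of m] B[OF U] r unfolding norm_mult norm_power
        by (intro mult_mono power_mono) auto
    qed
  qed
  have "(\<lambda>m. \<integral>U. F m U ^ i * (esym N j U * cnj (esym N k U)) \<partial>M) \<longlonglongrightarrow>
      (\<integral>U. resolvent_trace N r U ^ i * (esym N j U * cnj (esym N k U)) \<partial>M)"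
    by (intro conv bounded_measurable_intros)
  moreover have "(\<integral>U. F m U ^ i * (esym N j U * cnj (esym N k U)) \<partial>M) =
      (if j \<le> k then (\<integral>U. F m U ^ i * cnj (esym N (k - j) U) \<partial>M) else 0)" for m
    using integral_esym_esym[OF entry_poly_power[OF F] k, of m i j] by (simp add: mult.assoc)
  moreover have "(\<lambda>m. if j \<le> k then (\<integral>U. F m U ^ i * cnj (esym N (k - j) U) \<partial>M) else 0) \<longlonglongrightarrow>
      (if j \<le> k then (\<integral>U. resolvent_trace N r U ^ i * cnj (esym N (k - j) U) \<partial>M) else 0)"
    using conv[of "\<lambda>U. cnj (esym N (k - j) U)"] by (auto intro: bounded_measurable_intros)
  ultimately show ?thesis by (simp add: LIMSEQ_unique mult.assoc)
qed

text \<open>Z(r) T(r) is again linear in the e_i, with the extra weights -i. Hence the integral with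
  T^(j+1) can also be written through integrals with T^j. Expanded in the e_i, both forms become
  convolutions, and \<open>geometric_convolution_choose\<close> solves the resulting recursion in
  j.\<close>

lemma integral_secular_resolvent_esym:
  assumes r: "cmod r < 1" and k: "k \<le> N"
  shows "(\<integral>U. secular N r U * resolvent_trace N r U ^ j * cnj (esym N k U) \<partial>M) =
    (-1) ^ k * (-1) ^ j * r ^ k * of_nat (k choose j)"
proof -
  let ?T = "resolvent_trace N r"
  \<comment> \<open>The sign turns the powers of -r into powers of r.\<close>
  define a where "a j i = (-1) ^ i * (\<integral>U. ?T U ^ j * cnj (esym N i U) \<partial>M)" for j i
  have expand: "(-1) ^ k * (\<integral>U. (\<Sum>i\<le>N. c i * (- r) ^ i * esym N i U) * ?T U ^ j * cnj (esym N k U) \<partial>M) =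
      (\<Sum>i\<le>k. c i * r ^ i * a j (k - i))" if k: "k \<le> N" for c j k
  proof -
    have "(\<integral>U. (\<Sum>i\<le>N. c i * (- r) ^ i * esym N i U) * ?T U ^ j * cnj (esym N k U) \<partial>M) =
        (\<integral>U. (\<Sum>i\<le>N. c i * (- r) ^ i * (?T U ^ j * esym N i U * cnj (esym N k U))) \<partial>M)"
      by (simp add: sum_distrib_left sum_distrib_right mult_ac)
    also have "\<dots> = (\<Sum>i\<le>N. c i * (- r) ^ i * (\<integral>U. ?T U ^ j * esym N i U * cnj (esym N k U) \<partial>M))"
      by (subst Bochner_Integration.integral_sum)
         (auto intro!: bounded_measurable_integrable bounded_measurable_intros bounded_measurable_resolvent_trace r)
    also have "\<dots> = (\<Sum>i\<le>N. if i \<le> k then c i * (- r) ^ i * (\<integral>U. ?T U ^ j * cnj (esym N (k - i) U) \<partial>M) else 0)"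
      using integral_resolvent_trace_esym[OF r k] by (intro sum.cong refl) simp
    also have "\<dots> = (\<Sum>i\<le>k. c i * (- r) ^ i * (\<integral>U. ?T U ^ j * cnj (esym N (k - i) U) \<partial>M))"
      using k by (intro sum.mono_neutral_cong_right) auto
    finally have "(-1) ^ k * (\<integral>U. (\<Sum>i\<le>N. c i * (- r) ^ i * esym N i U) * ?T U ^ j * cnj (esym N k U) \<partial>M) =
        (\<Sum>i\<le>k. (-1) ^ k * (c i * (- r) ^ i * (\<integral>U. ?T U ^ j * cnj (esym N (k - i) U) \<partial>M)))"
      by (simp add: sum_distrib_left)
    also have "\<dots> = (\<Sum>i\<le>k. c i * r ^ i * a j (k - i))"
    proof (rule sum.cong[OF refl])
      fix i assume "i \<in> {..k}"
      hence "(-1) ^ k = (-1) ^ i * ((-1) ^ (k - i) :: complex)" by (simp add: power_add[symmetric])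
      moreover have "(-1) ^ i * ((-1) ^ i :: complex) = 1" by (simp add: power_mult_distrib[symmetric])
      ultimately show "(-1) ^ k * (c i * (- r) ^ i * (\<integral>U. ?T U ^ j * cnj (esym N (k - i) U) \<partial>M)) =
          c i * r ^ i * a j (k - i)"
        by (simp add: a_def power_minus[of r])
    qed
    finally show ?thesis .
  qed
  have "(\<Sum>i\<le>k. r ^ i * a j (k - i)) = (-1) ^ j * r ^ k * of_nat (k choose j)"
  proof (rule geometric_convolution_choose[OF _ _ k])
    show "a 0 k = (if k = 0 then 1 else 0)" for k
      by (simp only: a_def power_0 mult_1 integral_cnj_esym) simp
    fix j k assume k: "k \<le> N"
    have "(\<Sum>i\<le>k. r ^ i * a (Suc j) (k - i)) =
        (-1) ^ k * (\<integral>U. secular N r U * ?T U ^ Suc j * cnj (esym N k U) \<partial>M)"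
      using expand[OF k, of "\<lambda>_. 1" "Suc j"] by (simp add: secular_def)
    also have "(\<integral>U. secular N r U * ?T U ^ Suc j * cnj (esym N k U) \<partial>M) =
        (\<integral>U. - ((\<Sum>i\<le>N. of_nat i * (- r) ^ i * esym N i U) * ?T U ^ j * cnj (esym N k U)) \<partial>M)"
    proof (rule Bochner_Integration.integral_cong[OF refl])
      fix U assume "U \<in> space M"
      hence "secular N r U \<noteq> 0" using secular_nonzero[OF _ r] by (simp add: space_eq)
      hence "secular N r U * ?T U = - (\<Sum>i\<le>N. of_nat i * (- r) ^ i * esym N i U)"
        by (simp add: resolvent_trace_def)
      thus "secular N r U * ?T U ^ Suc j * cnj (esym N k U) =
          - ((\<Sum>i\<le>N. of_nat i * (- r) ^ i * esym N i U) * ?T U ^ j * cnj (esym N k U))"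
        by (simp only: power_Suc mult.assoc[symmetric] mult_minus_left)
    qed
    also have "(-1) ^ k * \<dots> = - (\<Sum>i\<le>k. of_nat i * r ^ i * a j (k - i))"
      using expand[OF k, of of_nat j] by simp
    finally show "(\<Sum>i\<le>k. r ^ i * a (Suc j) (k - i)) = - (\<Sum>i\<le>k. of_nat i * r ^ i * a j (k - i))" .
  qed
  moreover have "(-1) ^ k * (\<integral>U. secular N r U * ?T U ^ j * cnj (esym N k U) \<partial>M) = (\<Sum>i\<le>k. r ^ i * a j (k - i))"
    using expand[OF k, of "\<lambda>_. 1" j] by (simp add: secular_def)
  moreover have "(-1) ^ k * ((-1) ^ k * x) = x" for x :: complex
    by (simp add: mult.assoc[symmetric] power_mult_distrib[symmetric])
  ultimately show ?thesis by (metis (no_types, lifting) mult.assoc)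
qed

end

context haar
begin

section \<open>The exponential of the trace, first for |r| < 1 and then at r = 1\<close>

lemma cnj_secular_1: "cnj (secular N 1 U) = (\<Sum>k\<le>N. (-1) ^ k * cnj (esym N k U))"
  by (simp add: secular_def)

text \<open>Unlike the bound for T(r) itself, this one stays finite as r tends to 1.\<close>

lemma norm_exp_resolvent_trace_le:
  assumes U: "U \<in> unitary_group N" and r: "cmod r \<le> 1" and s: "s \<ge> 0" and nz: "secular N r U \<noteq> 0"
  shows "cmod (exp (- 2 * of_real s * resolvent_trace N r U)) \<le> exp (s * real N)"
proof -
  have "2 * s * (- real N / 2) \<le> 2 * s * Re (resolvent_trace N r U)"
    using s Re_resolvent_trace_ge(1)[OF U r nz] by (intro mult_left_mono) auto
  thus ?thesis by simp
qed

text \<open>The exponential series is integrated term by term, which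
  \<open>norm_resolvent_trace_le\<close> permits for fixed r. The result is a finite sum, as
  binomial(k, j) = 0 for j > N >= k.\<close>

lemma integral_secular_exp_resolvent:
  assumes r: "cmod r < 1"
  shows "(\<integral>U. secular N r U * exp (- 2 * of_real s * resolvent_trace N r U) * cnj (secular N 1 U) \<partial>M) =
    (\<Sum>j\<le>N. (2 * of_real s) ^ j / fact j * (\<Sum>k\<le>N. r ^ k * of_nat (k choose j)))"
proof -
  let ?T = "resolvent_trace N r"
  let ?G = "\<lambda>j U. secular N r U * ?T U ^ j * cnj (secular N 1 U)"
  define x :: complex where "x = - 2 * of_real s"
  define B where "B = real N / (1 - cmod r)"
  have bm: "bounded_measurable (?G j)" for j
    by (intro bounded_measurable_mult bounded_measurable_power bounded_measurable_cnj
        bounded_measurable_secular bounded_measurable_resolvent_trace r)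
  have G: "(\<integral>U. ?G j U \<partial>M) = (-1) ^ j * (\<Sum>k\<le>N. r ^ k * of_nat (k choose j))" for j
  proof -
    have "(\<integral>U. ?G j U \<partial>M) = (\<integral>U. (\<Sum>k\<le>N. (-1) ^ k * (secular N r U * ?T U ^ j * cnj (esym N k U))) \<partial>M)"
      by (simp only: cnj_secular_1 sum_distrib_left mult.left_commute)
    also have "\<dots> = (\<Sum>k\<le>N. \<integral>U. (-1) ^ k * (secular N r U * ?T U ^ j * cnj (esym N k U)) \<partial>M)"
      by (intro Bochner_Integration.integral_sum bounded_measurable_integrable bounded_measurable_mult
        bounded_measurable_power bounded_measurable_cnj bounded_measurable_const bounded_measurable_esym
        bounded_measurable_secular bounded_measurable_resolvent_trace r)
    also have "\<dots> = (\<Sum>k\<le>N. (-1) ^ k * (\<integral>U. secular N r U * ?T U ^ j * cnj (esym N k U) \<partial>M))"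
      by simp
    also have "\<dots> = (\<Sum>k\<le>N. (-1) ^ j * (r ^ k * of_nat (k choose j)))"
    proof (rule sum.cong[OF refl])
      fix k assume "k \<in> {..N}"
      hence k: "k \<le> N" by simp
      have "(-1) ^ k * ((-1) ^ k * y) = y" for y :: complex
        by (simp add: mult.assoc[symmetric] power_mult_distrib[symmetric])
      thus "(-1) ^ k * (\<integral>U. secular N r U * ?T U ^ j * cnj (esym N k U) \<partial>M) =
          (-1) ^ j * (r ^ k * of_nat (k choose j))"
        unfolding integral_secular_resolvent_esym[OF r k] by (simp only: mult.assoc)
    qed
    finally show ?thesis by (simp add: sum_distrib_left)
  qed
  have "(\<lambda>m. \<integral>U. (\<Sum>j<m. x ^ j / fact j * ?G j U) \<partial>M) \<longlonglongrightarrow>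
      (\<integral>U. secular N r U * exp (x * ?T U) * cnj (secular N 1 U) \<partial>M)"
  proof (rule integral_tendsto_bounded)
    show "(\<lambda>U. \<Sum>j<m. x ^ j / fact j * ?G j U) \<in> borel_measurable M" for m
      by (intro bounded_measurableD bounded_measurable_sum bounded_measurable_mult[OF bounded_measurable_const] bm)
    show "(\<lambda>U. secular N r U * exp (x * ?T U) * cnj (secular N 1 U)) \<in> borel_measurable M"
      by (intro borel_measurable_times bounded_measurableD[OF bounded_measurable_secular]
          bounded_measurableD[OF bounded_measurable_cnj[OF bounded_measurable_secular]]
          borel_measurable_continuous_on[OF continuous_on_exp[OF continuous_on_id]]
          measurable_resolvent_trace borel_measurable_const)
    fix U assume U: "U \<in> unitary_group N"
    have eq: "(\<Sum>j<m. x ^ j / fact j * ?G j U) =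
        secular N r U * (\<Sum>j<m. (x * ?T U) ^ j /\<^sub>R fact j) * cnj (secular N 1 U)" for m
      by (simp add: sum_distrib_left sum_distrib_right power_mult_distrib scaleR_conv_of_real field_simps)
    have "(\<lambda>m. \<Sum>j<m. (x * ?T U) ^ j /\<^sub>R fact j) \<longlonglongrightarrow> exp (x * ?T U)"
      using exp_converges[of "x * ?T U"] by (simp add: sums_def)
    thus "(\<lambda>m. \<Sum>j<m. x ^ j / fact j * ?G j U) \<longlonglongrightarrow> secular N r U * exp (x * ?T U) * cnj (secular N 1 U)"
      unfolding eq by (intro tendsto_mult tendsto_const)
    fix m
    have "cmod (\<Sum>j<m. (x * ?T U) ^ j /\<^sub>R fact j) \<le> exp (cmod x * B)"
    proof -
      have "cmod (\<Sum>j<m. (x * ?T U) ^ j /\<^sub>R fact j) \<le> (\<Sum>j<m. (cmod x * B) ^ j /\<^sub>R fact j)"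
      proof (rule sum_norm_le)
        fix j
        have "cmod (x * ?T U) \<le> cmod x * B"
          using norm_resolvent_trace_le[OF U r] unfolding norm_mult B_def by (intro mult_left_mono) auto
        hence p: "cmod (x * ?T U) ^ j \<le> (cmod x * B) ^ j" by (intro power_mono) auto
        show "cmod ((x * ?T U) ^ j /\<^sub>R fact j) \<le> (cmod x * B) ^ j /\<^sub>R fact j"
          unfolding norm_scaleR norm_power real_scaleR_def by (intro mult_mono p) auto
      qed
      also have "\<dots> \<le> exp (cmod x * B)"
      proof -
        have "B \<ge> 0" using r by (simp add: B_def)
        hence "(\<Sum>j<m. (cmod x * B) ^ j /\<^sub>R fact j) \<le> (\<Sum>j. (cmod x * B) ^ j /\<^sub>R fact j)"
          by (intro sum_le_suminf sums_summable[OF exp_converges]) auto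
        thus ?thesis by (simp only: sums_unique[OF exp_converges, symmetric])
      qed
      finally show ?thesis .
    qed
    thus "cmod (\<Sum>j<m. x ^ j / fact j * ?G j U) \<le> 2 ^ N * exp (cmod x * B) * 2 ^ N"
      unfolding eq norm_mult complex_mod_cnj
      using norm_secular_le[OF U, of r] norm_secular_le[OF U, of 1] r by (intro mult_mono) auto
  qed
  moreover have "(\<integral>U. (\<Sum>j<m. x ^ j / fact j * ?G j U) \<partial>M) =
      (\<Sum>j<m. (2 * of_real s) ^ j / fact j * (\<Sum>k\<le>N. r ^ k * of_nat (k choose j)))" for m
  proof -
    have "(\<integral>U. (\<Sum>j<m. x ^ j / fact j * ?G j U) \<partial>M) = (\<Sum>j<m. \<integral>U. x ^ j / fact j * ?G j U \<partial>M)"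
      by (intro Bochner_Integration.integral_sum bounded_measurable_integrable
          bounded_measurable_mult[OF bounded_measurable_const] bm)
    also have "\<dots> = (\<Sum>j<m. x ^ j / fact j * (\<integral>U. ?G j U \<partial>M))" by simp
    also have "\<dots> = (\<Sum>j<m. (2 * of_real s) ^ j / fact j * (\<Sum>k\<le>N. r ^ k * of_nat (k choose j)))"
    proof (rule sum.cong[OF refl])
      fix j
      have "x * (-1) = 2 * of_real s" by (simp add: x_def)
      hence "x ^ j * (-1) ^ j = (2 * of_real s) ^ j" by (simp only: power_mult_distrib[symmetric])
      moreover have "x ^ j / fact j * ((-1) ^ j * y) = (x ^ j * (-1) ^ j) / fact j * y" for y
        by (simp only: times_divide_eq_left times_divide_eq_right mult_ac)
      ultimately have "x ^ j / fact j * ((-1) ^ j * y) = (2 * of_real s) ^ j / fact j * y" for y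
        by (simp only:)
      thus "x ^ j / fact j * (\<integral>U. ?G j U \<partial>M) =
        (2 * of_real s) ^ j / fact j * (\<Sum>k\<le>N. r ^ k * of_nat (k choose j))" unfolding G .
    qed
    finally show ?thesis .
  qed
  moreover have "(\<lambda>m. \<Sum>j<m. (2 * of_real s) ^ j / fact j * (\<Sum>k\<le>N. r ^ k * of_nat (k choose j))) \<longlonglongrightarrow>
      (\<Sum>j\<le>N. (2 * of_real s) ^ j / fact j * (\<Sum>k\<le>N. r ^ k * of_nat (k choose j)))"
  proof (rule sums_finite[unfolded sums_def])
    fix j assume "j \<notin> {..N}"
    hence "(\<Sum>k\<le>N. r ^ k * of_nat (k choose j)) = 0"
      by (intro sum.neutral) (auto simp: binomial_eq_0)
    thus "(2 * of_real s) ^ j / fact j * (\<Sum>k\<le>N. r ^ k * of_nat (k choose j)) = 0" by simp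
  qed simp
  ultimately show ?thesis by (simp add: LIMSEQ_unique x_def)
qed

text \<open>At r = 1 the modulus of exp(-2 s T) is exactly exp(s N), and the real part of the phase
  is the cosine.\<close>

lemma integral_secular_cos:
  assumes s: "s \<ge> 0"
  shows "(\<integral>U. (cmod (secular N 1 U))\<^sup>2 * cos (2 * s * Im (resolvent_trace N 1 U)) \<partial>M) =
    exp (- s * real N) * (\<Sum>j\<le>N. real (Suc N choose Suc j) * (2 * s) ^ j / fact j)"
proof -
  define r where "r n = complex_of_real (1 - 1 / real (n + 2))" for n
  have r: "cmod (r n) < 1" for n
  proof -
    have "1 / real (n + 2) > 0" "1 / real (n + 2) \<le> 1" by (auto simp: divide_le_eq)
    thus ?thesis unfolding r_def norm_of_real by linarith
  qed
  have "(\<lambda>n. 1 - 1 / real (n + 2)) \<longlonglongrightarrow> 1" by real_asymp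
  hence r1: "r \<longlonglongrightarrow> 1" unfolding r_def by (metis of_real_1 tendsto_of_real)
  let ?F = "\<lambda>r U. secular N r U * exp (- 2 * of_real s * resolvent_trace N r U) * cnj (secular N 1 U)"
  have meas: "?F r \<in> borel_measurable M" for r
    by (intro borel_measurable_times bounded_measurableD[OF bounded_measurable_secular]
          bounded_measurableD[OF bounded_measurable_cnj[OF bounded_measurable_secular]]
          borel_measurable_continuous_on[OF continuous_on_exp[OF continuous_on_id]]
          measurable_resolvent_trace borel_measurable_const)
  have bound: "cmod (?F r U) \<le> 2 ^ N * exp (s * real N) * 2 ^ N"
    if U: "U \<in> unitary_group N" and r: "cmod r \<le> 1" for r U
  proof (cases "secular N r U = 0")
    case False
    thus ?thesis unfolding norm_mult complex_mod_cnj
      using norm_secular_le[OF U, of 1] by (intro mult_mono norm_secular_le norm_exp_resolvent_trace_le U r s) auto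
  qed simp
  have "(\<lambda>n. \<integral>U. ?F (r n) U \<partial>M) \<longlonglongrightarrow> (\<integral>U. ?F 1 U \<partial>M)"
  proof (rule integral_tendsto_bounded[OF meas meas _ bound])
    fix U
    show "(\<lambda>n. ?F (r n) U) \<longlonglongrightarrow> ?F 1 U"
    \<comment> \<open>At a zero of \<open>secular N 1 U\<close> the trace may fail to converge, but
      the factor \<open>cnj (secular N 1 U)\<close> makes all terms 0.\<close>
    proof (cases "secular N 1 U = 0")
      case False
      have sec: "(\<lambda>n. secular N (r n) U) \<longlonglongrightarrow> secular N 1 U"
        unfolding secular_def by (intro tendsto_intros r1)
      have "(\<lambda>n. resolvent_trace N (r n) U) \<longlonglongrightarrow> resolvent_trace N 1 U"
        unfolding resolvent_trace_def by (intro tendsto_divide tendsto_intros r1 sec False)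
      thus ?thesis by (intro tendsto_mult sec tendsto_exp tendsto_const)
    qed simp
  next
    show "cmod (r n) \<le> 1" for n using r[of n] by simp
  qed
  moreover have "(\<lambda>n. \<integral>U. ?F (r n) U \<partial>M) \<longlonglongrightarrow>
      (\<Sum>j\<le>N. (2 * of_real s) ^ j / fact j * (\<Sum>k\<le>N. 1 ^ k * of_nat (k choose j)))"
    unfolding integral_secular_exp_resolvent[OF r] by (intro tendsto_intros r1)
  ultimately have "(\<integral>U. ?F 1 U \<partial>M) =
      (\<Sum>j\<le>N. (2 * of_real s) ^ j / fact j * (\<Sum>k\<le>N. 1 ^ k * of_nat (k choose j)))"
    by (rule LIMSEQ_unique)
  also have "\<dots> = of_real (\<Sum>j\<le>N. real (Suc N choose Suc j) * (2 * s) ^ j / fact j)"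
  proof -
    \<comment> \<open>The hockey-stick identity; it produces the Laguerre coefficients.\<close>
    have "(\<Sum>k\<le>N. 1 ^ k * of_nat (k choose j)) = (of_nat (Suc N choose Suc j) :: complex)" for j
      using sum_choose_upper[of j N] by (simp add: of_nat_sum[symmetric] atMost_atLeast0 del: of_nat_sum)
    thus ?thesis by (simp add: mult.commute del: binomial_Suc_Suc)
  qed
  finally have "Re (\<integral>U. ?F 1 U \<partial>M) = (\<Sum>j\<le>N. real (Suc N choose Suc j) * (2 * s) ^ j / fact j)"
    by (simp only: Re_complex_of_real)
  moreover have "Re (\<integral>U. ?F 1 U \<partial>M) = (\<integral>U. Re (?F 1 U) \<partial>M)"
    using meas[of 1] bound[of _ 1] by (intro integral_Re[symmetric] bounded_measurable_integrable bounded_measurableI) auto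
  moreover have "(\<integral>U. Re (?F 1 U) \<partial>M) =
      (\<integral>U. exp (s * real N) * ((cmod (secular N 1 U))\<^sup>2 * cos (2 * s * Im (resolvent_trace N 1 U))) \<partial>M)"
  proof (rule Bochner_Integration.integral_cong[OF refl])
    fix U assume "U \<in> space M"
    hence U: "U \<in> unitary_group N" by (simp add: space_eq)
    show "Re (?F 1 U) = exp (s * real N) *
        ((cmod (secular N 1 U))\<^sup>2 * cos (2 * s * Im (resolvent_trace N 1 U)))"
    proof (cases "secular N 1 U = 0")
      case False
      have R: "Re (resolvent_trace N 1 U) = - real N / 2"
        using Re_resolvent_trace_ge(2)[OF U _ False] by simp
      have "?F 1 U = of_real ((cmod (secular N 1 U))\<^sup>2) * exp (- 2 * of_real s * resolvent_trace N 1 U)"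
        unfolding complex_norm_square by (simp add: mult_ac)
      moreover have "Re (of_real a * z) = a * Re z" for a z by simp
      ultimately have "Re (?F 1 U) = (cmod (secular N 1 U))\<^sup>2 * Re (exp (- 2 * of_real s * resolvent_trace N 1 U))"
        by (simp only:)
      also have "Re (exp (- 2 * of_real s * resolvent_trace N 1 U)) =
          exp (s * real N) * cos (2 * s * Im (resolvent_trace N 1 U))"
        by (simp add: Re_exp R)
      finally show ?thesis by simp
    qed simp
  qed
  ultimately have "exp (s * real N) * (\<integral>U. (cmod (secular N 1 U))\<^sup>2 * cos (2 * s * Im (resolvent_trace N 1 U)) \<partial>M) =
      (\<Sum>j\<le>N. real (Suc N choose Suc j) * (2 * s) ^ j / fact j)" by simp
  thus ?thesis by (simp add: exp_minus field_simps)
qed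

end

context haar
begin

text \<open>The substitution s = x / N pulls a factor N out of the kernel formula and brings the
  integrand to the form of \<open>has_bochner_integral_laguerre\<close>. Working with nonnegative
  integrals lets Tonelli's theorem exchange the order.\<close>

lemma integral_secular_Im_resolvent:
  assumes N: "N \<ge> 1"
  shows "(\<integral>U. (cmod (secular N 1 U))\<^sup>2 * \<bar>Im (resolvent_trace N 1 U)\<bar> \<partial>M) =
    real N / pi * (real N + 1 -
      (\<Sum>j\<in>{2..N}. real (Suc N choose Suc j) * (2 / real N) ^ j / (real j * (real j - 1))))"
proof -
  define w where "w U = (cmod (secular N 1 U))\<^sup>2" for U
  define y where "y U = Im (resolvent_trace N 1 U)" for U
  define g where "g x = exp (- x) * (\<Sum>j\<le>N. real (Suc N choose Suc j) * (2 * x / real N) ^ j / fact j)" for x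
  define I where "I = real N + 1 -
      (\<Sum>j\<in>{2..N}. real (Suc N choose Suc j) * (2 / real N) ^ j / (real j * (real j - 1)))"
  have w_meas [measurable]: "w \<in> borel_measurable M"
    unfolding w_def[abs_def]
    by (intro borel_measurable_power borel_measurable_norm[THEN measurable_compose[rotated]]
        bounded_measurableD[OF bounded_measurable_secular])
  have y_meas [measurable]: "y \<in> borel_measurable M"
    unfolding y_def[abs_def]
    by (rule measurable_compose[OF measurable_resolvent_trace borel_measurable_Im])
  have w0: "w U \<ge> 0" for U by (simp add: w_def)
  have wint: "integrable M (\<lambda>U. w U * cos (c * y U))" for c
  proof (rule integrable_const_bound[where B = "(2 ^ N)\<^sup>2"])
    show "AE U in M. norm (w U * cos (c * y U)) \<le> (2 ^ N)\<^sup>2"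
    proof (rule AE_I2)
      fix U assume "U \<in> space M"
      hence "w U \<le> (2 ^ N)\<^sup>2"
        unfolding w_def using norm_secular_le[of U N 1] by (intro power_mono) (auto simp: space_eq)
      hence "w U * \<bar>cos (c * y U)\<bar> \<le> (2 ^ N)\<^sup>2 * 1" using w0 by (intro mult_mono) auto
      thus "norm (w U * cos (c * y U)) \<le> (2 ^ N)\<^sup>2" using w0[of U] by (simp add: abs_mult)
    qed
  qed measurable
  have Ecos: "(\<integral>U. w U * cos (2 * (x / real N) * y U) \<partial>M) = g x" if "x \<ge> 0" for x
    using integral_secular_cos[of "x / real N"] that N by (simp add: w_def y_def g_def)
  have g0: "g 0 = real N + 1"
  proof -
    have "{..N} = insert 0 {1..N}" by auto
    thus ?thesis by (simp add: g_def)
  qed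
  have Ew: "(\<integral>U. w U \<partial>M) = real N + 1" using Ecos[of 0] g0 by simp
  \<comment> \<open>From cos <= 1 under the integral. It makes the integrand in x nonnegative, so
    that its nonnegative and its Bochner integral agree.\<close>
  have g_le: "g x \<le> real N + 1" if "x > 0" for x
  proof -
    have "(\<integral>U. w U * cos (2 * (x / real N) * y U) \<partial>M) \<le> (\<integral>U. w U * cos (0 * y U) \<partial>M)"
      by (intro integral_mono wint mult_left_mono w0) simp
    thus ?thesis using Ecos[of x] that Ew by simp
  qed
  \<comment> \<open>The constants combine to N / pi * (pi / 2) * |2 y / N| = |y|.\<close>
  have kernel: "(\<integral>\<^sup>+x. ennreal (w U * (real N / pi * (indicator {0<..} x * ((1 - cos (2 * y U / real N * x)) / x\<^sup>2)))) \<partial>lborel) =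
      ennreal (w U * \<bar>y U\<bar>)" for U
  proof -
    have "has_bochner_integral lborel
        (\<lambda>x. w U * (real N / pi * (indicator {0<..} x * ((1 - cos (2 * y U / real N * x)) / x\<^sup>2))))
        (w U * (real N / pi * (pi / 2 * \<bar>2 * y U / real N\<bar>)))"
      by (intro has_bochner_integral_mult_right has_bochner_integral_one_minus_cos)
    moreover have "w U * (real N / pi * (pi / 2 * \<bar>2 * y U / real N\<bar>)) = w U * \<bar>y U\<bar>"
      using N by (simp add: abs_mult abs_divide)
    ultimately show ?thesis
      using w0 by (subst nn_integral_eq_integral) (auto simp: has_bochner_integral_iff intro!: AE_I2)
  qed
  interpret pair_sigma_finite M lborel ..
  have "(\<integral>\<^sup>+U. ennreal (w U * \<bar>y U\<bar>) \<partial>M) =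
      (\<integral>\<^sup>+U. \<integral>\<^sup>+x. ennreal (w U * (real N / pi * (indicator {0<..} x * ((1 - cos (2 * y U / real N * x)) / x\<^sup>2)))) \<partial>lborel \<partial>M)"
    by (simp only: kernel)
  also have "\<dots> = (\<integral>\<^sup>+x. \<integral>\<^sup>+U. ennreal (w U * (real N / pi * (indicator {0<..} x * ((1 - cos (2 * y U / real N * x)) / x\<^sup>2)))) \<partial>M \<partial>lborel)"
    by (rule Fubini'[symmetric]) measurable
  also have "\<dots> = (\<integral>\<^sup>+x. ennreal (real N / pi * (indicator {0<..} x * ((real N + 1 - g x) / x\<^sup>2))) \<partial>lborel)"
  proof (rule nn_integral_cong)
    fix x :: real
    let ?c = "real N / pi * (indicator {0<..} x / x\<^sup>2)"
    have c0: "?c \<ge> 0" by simp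
    have eq: "w U * (real N / pi * (indicator {0<..} x * ((1 - cos (2 * y U / real N * x)) / x\<^sup>2))) =
        ?c * (w U * cos (0 * y U) - w U * cos (2 * (x / real N) * y U))" for U
    proof -
      have "v * (n * (i * ((1 - c) / d))) = n * (i / d) * (v * 1 - v * c)" for v n i c d :: real
        by (simp add: diff_divide_distrib algebra_simps)
      moreover have "2 * y U / real N * x = 2 * (x / real N) * y U" by simp
      ultimately show ?thesis by (simp only: mult_zero_left cos_zero)
    qed
    have "(\<integral>\<^sup>+U. ennreal (w U * (real N / pi * (indicator {0<..} x * ((1 - cos (2 * y U / real N * x)) / x\<^sup>2)))) \<partial>M) =
        ennreal (\<integral>U. ?c * (w U * cos (0 * y U) - w U * cos (2 * (x / real N) * y U)) \<partial>M)"
      unfolding eq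
    proof (rule nn_integral_eq_integral)
      show "integrable M (\<lambda>U. ?c * (w U * cos (0 * y U) - w U * cos (2 * (x / real N) * y U)))"
        by (intro integrable_mult_right Bochner_Integration.integrable_diff wint)
      show "AE U in M. 0 \<le> ?c * (w U * cos (0 * y U) - w U * cos (2 * (x / real N) * y U))"
      proof (rule AE_I2)
        fix U
        have "w U * cos (2 * (x / real N) * y U) \<le> w U * 1" using w0 by (intro mult_left_mono) auto
        thus "0 \<le> ?c * (w U * cos (0 * y U) - w U * cos (2 * (x / real N) * y U))"
          by (intro mult_nonneg_nonneg[OF c0]) simp
      qed
    qed
    also have "(\<integral>U. ?c * (w U * cos (0 * y U) - w U * cos (2 * (x / real N) * y U)) \<partial>M) =
        ?c * ((\<integral>U. w U * cos (0 * y U) \<partial>M) - (\<integral>U. w U * cos (2 * (x / real N) * y U) \<partial>M))"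
      by (simp only: integral_mult_right_zero Bochner_Integration.integral_diff[OF wint wint])
    also have "\<dots> = real N / pi * (indicator {0<..} x * ((real N + 1 - g x) / x\<^sup>2))"
    proof (cases "x > 0")
      case True
      have "(\<integral>U. w U * cos (0 * y U) \<partial>M) = real N + 1" by (simp add: Ew)
      thus ?thesis unfolding Ecos[OF less_imp_le[OF True]] by simp
    qed simp
    finally show "(\<integral>\<^sup>+U. ennreal (w U * (real N / pi * (indicator {0<..} x * ((1 - cos (2 * y U / real N * x)) / x\<^sup>2)))) \<partial>M) =
        ennreal (real N / pi * (indicator {0<..} x * ((real N + 1 - g x) / x\<^sup>2)))" .
  qed
  also have "\<dots> = ennreal (real N / pi * I)"
  proof -
    have "has_bochner_integral lborel (\<lambda>x. real N / pi * (indicator {0<..} x * ((real N + 1 - g x) / x\<^sup>2)))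
        (real N / pi * I)"
      unfolding g_def I_def by (intro has_bochner_integral_mult_right has_bochner_integral_laguerre N)
    thus ?thesis using g_le
      by (subst nn_integral_eq_integral) (auto simp: has_bochner_integral_iff indicator_def intro!: AE_I2)
  qed
  finally have nn: "(\<integral>\<^sup>+U. ennreal (w U * \<bar>y U\<bar>) \<partial>M) = ennreal (real N / pi * I)" .
  \<comment> \<open>\<open>ennreal\<close> sends negative numbers to 0, so the value can be read off
    only once its sign is known.\<close>
  have "I \<ge> 0"
  proof -
    have "indicator {0<..} x * ((real N + 1 - g x) / x\<^sup>2) \<ge> 0" for x
      using g_le by (auto simp: indicator_def)
    hence "(LINT x|lborel. indicator {0<..} x * ((real N + 1 - g x) / x\<^sup>2)) \<ge> 0"
      by (intro Bochner_Integration.integral_nonneg)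
    thus ?thesis
      unfolding g_def I_def has_bochner_integral_integral_eq[OF has_bochner_integral_laguerre[OF N]] .
  qed
  have "(\<integral>U. w U * \<bar>y U\<bar> \<partial>M) = enn2real (\<integral>\<^sup>+U. ennreal (w U * \<bar>y U\<bar>) \<partial>M)"
    using w0 by (intro integral_eq_nn_integral AE_I2) auto
  also have "\<dots> = real N / pi * I" using \<open>I \<ge> 0\<close> by (simp add: nn)
  finally show ?thesis by (simp only: w_def y_def I_def)
qed

end

theorem mainTheorem3:
  fixes \<mu> :: "nat \<Rightarrow> complex mat measure"
  assumes haar: "\<And>N. N \<ge> 1 \<Longrightarrow> is_haar_measure N (\<mu> N)"
  shows "(\<lambda>N. 1 / real N ^ 2 * (\<integral>U. cmod (V_fun U 0) * cmod (V_deriv U 0) \<partial>\<mu> N))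
           \<longlonglongrightarrow> (exp 1 ^ 2 - 5) / (4 * pi)
         \<and> F_lim \<mu> (1 / 2) 1 = (exp 1 ^ 2 - 5) / (4 * pi)"
proof
  let ?I = "\<lambda>N. \<integral>U. cmod (V_fun U 0) * cmod (V_deriv U 0) \<partial>\<mu> N"
  have I: "1 / real N ^ 2 * ?I N = 1 / (pi * real N) * (real N + 1 -
      (\<Sum>j\<in>{2..N}. real (Suc N choose Suc j) * (2 / real N) ^ j / (real j * (real j - 1))))"
    if N: "N \<ge> 1" for N
  proof -
    interpret haar N "\<mu> N" by unfold_locales (rule haar[OF N])
    have "?I N = (\<integral>U. (cmod (secular N 1 U))\<^sup>2 * \<bar>Im (resolvent_trace N 1 U)\<bar> \<partial>\<mu> N)"
      by (rule Bochner_Integration.integral_cong[OF refl]) (simp add: space_eq V_fun_V_deriv_0)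
    also have "\<dots> = real N / pi * (real N + 1 -
      (\<Sum>j\<in>{2..N}. real (Suc N choose Suc j) * (2 / real N) ^ j / (real j * (real j - 1))))"
      by (rule integral_secular_Im_resolvent[OF N])
    also have "1 / real N ^ 2 * (real N / pi * x) = 1 / (pi * real N) * x" for x
      using N by (simp add: power2_eq_square)
    finally show ?thesis .
  qed
  \<comment> \<open>Nothing is assumed about \<open>\<mu> 0\<close>, so both limits are compared
    from N = 1 on.\<close>
  have ev: "eventually (\<lambda>N. N \<ge> 1) sequentially" by (rule eventually_ge_at_top)
  show lim: "(\<lambda>N. 1 / real N ^ 2 * ?I N) \<longlonglongrightarrow> (exp 1 ^ 2 - 5) / (4 * pi)"
    by (rule Lim_transform_eventually[OF laguerre_sum_tendsto])
       (use ev in eventually_elim, simp only: I)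
  have "(\<lambda>N. real N powr (- (1 ^ 2) - 2 * (1 / 2)) * F_fin \<mu> N (1 / 2) 1) \<longlonglongrightarrow> (exp 1 ^ 2 - 5) / (4 * pi)"
  proof (rule Lim_transform_eventually[OF lim], use ev in eventually_elim)
    fix N :: nat assume N: "N \<ge> 1"
    have "real N powr (- (1 ^ 2) - 2 * (1 / 2)) = 1 / real N ^ 2"
      using N powr_minus_divide[of "real N" 2] by simp
    \<comment> \<open>For h = 1/2 and k = 1 both exponents are 1, and \<open>x powr 1 = x\<close>
      for all x >= 0, including 0.\<close>
    moreover have "F_fin \<mu> N (1 / 2) 1 = ?I N" by (simp add: F_fin_def)
    ultimately show "1 / real N ^ 2 * ?I N = real N powr (- (1 ^ 2) - 2 * (1 / 2)) * F_fin \<mu> N (1 / 2) 1"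
      by simp
  qed
  thus "F_lim \<mu> (1 / 2) 1 = (exp 1 ^ 2 - 5) / (4 * pi)"
    unfolding F_lim_def by (rule limI)
qed

end
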